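(* Let $\{Y_n\}_{n\ge 0}$ be a positive Harris and aperiodic Markov chain taking values in a measurable space $(\mathbb{S},\mathcal{S})$, with stationary distribution $\pi$. Let $f:(\mathbb{S},\mathcal{S})\to(\mathbb{R}^1,\mathcal{B}^1)$ be a measurable function, and define $$X_n=f(Y_n),\quad n=0,1,2,\ldots,\qquad M_n=\max_{0\le j\le n-1}X_j,\quad n=1,2,\ldots.$$ If $\pi\circ f^{-1}$ (i.e. the marginal law of $\{X_n\}$ under the stationary distribution $\pi$) is continuous and unbounded above, then there exists a continuous distribution function $G$ such that for each $s\in\mathbb{S}$ $$\sup_{x\in\mathbb{R}^1}\big|\mathbb{P}_{s}(M_n\le x)-G^n(x)\big|\to 0\quad\text{as } n\to\infty.$$
   Context: $\{Y_n\}$ is a time-homogeneous Markov chain on a general state space; the terminology is that of Meyn and Tweedie, "Markov Chains and Stochastic Stability". The chain is Harris recurrent if there is a nontrivial $\sigma$-finite measure $\varphi$ on $(\mathbb{S},\mathcal{S})$ such that for every $A\in\mathcal{S}$ with $\varphi(A)>0$ and every starting point $s\in\mathbb{S}$, the chain started at $s$ visits $A$ infinitely often with probability one. It is positive Harris if it is Harris recurrent and admits an invariant probability measure $\pi$ (which is then unique and is called the stationary distribution). It is aperiodic if its period equals one, i.e. there is no cyclic decomposition of $\mathbb{S}$, up to a $\pi$-null set, into $d\ge 2$ disjoint sets $D_0,\dots,D_{d-1}\in\mathcal{S}$ with one-step transition probability $1$ from each point of $D_i$ into $D_{i+1 \bmod d}$. $\mathcal{B}^1$ denotes the Borel $\sigma$-field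 of $\mathbb{R}^1=\mathbb{R}$. $\mathbb{P}_{s}$ denotes the law of the chain conditional on $Y_0=s$. The law $\pi\circ f^{-1}$ on $\mathbb{R}$ is continuous if its distribution function $x\mapsto\pi(f\le x)$ is continuous, and unbounded above if $\pi(f>x)>0$ for every $x\in\mathbb{R}$. A distribution function means a probability distribution function on $\mathbb{R}$, and $G^n(x)=(G(x))^n$. *)

theory Defs
  imports "HOL-Probability.Probability"
begin

definition transition_kernel :: "'a measure \<Rightarrow> ('a \<Rightarrow> 'a measure) \<Rightarrow> bool" where
  "transition_kernel S K \<longleftrightarrow> K \<in> measurable S (prob_algebra S)"

text \<open>
  The law \<open>P\<^sub>s\<close> of the chain with kernel \<open>K\<close> started at \<open>s\<close>, on the canonical path space
  \<open>PiM UNIV (\<lambda>_. S)\<close>; the chain itself is the coordinate process, \<open>Y\<^sub>n \<omega> = \<omega> n\<close>. The measure is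
  the Ionescu-Tulcea limit for the conditional law of coordinate \<open>n\<close> given the coordinates
  below \<open>n\<close>: the point mass at \<open>s\<close> for \<open>n = 0\<close>, and \<open>K (\<omega> (n - 1))\<close> for \<open>n > 0\<close>.
\<close>

definition chain_step :: "'a measure \<Rightarrow> ('a \<Rightarrow> 'a measure) \<Rightarrow> 'a \<Rightarrow> nat \<Rightarrow> (nat \<Rightarrow> 'a) \<Rightarrow> 'a measure" where
  "chain_step S K s n \<omega> = (case n of 0 \<Rightarrow> return S s | Suc m \<Rightarrow> K (\<omega> m))"

definition chain_law :: "'a measure \<Rightarrow> ('a \<Rightarrow> 'a measure) \<Rightarrow> 'a \<Rightarrow> (nat \<Rightarrow> 'a) measure" where
  "chain_law S K s =
     projective_family.lim UNIV (Ionescu_Tulcea.CI (chain_step S K s) (\<lambda>_. S)) (\<lambda>_. S)"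

lemma Ionescu_Tulcea_chain_step:
  fixes S :: "'a measure"
  assumes K: "transition_kernel S K" and s: "s \<in> space S"
  shows "Ionescu_Tulcea (chain_step S K s) (\<lambda>_. S)"
proof (rule Ionescu_Tulcea.intro)
  have K': "K \<in> measurable S (subprob_algebra S)"
    using K unfolding transition_kernel_def by (rule measurable_prob_algebraD)
  fix n
  show "chain_step S K s n \<in> measurable (PiM {0..<n} (\<lambda>_. S)) (subprob_algebra S)"
  proof (cases n)
    case 0
    have "return S s \<in> space (subprob_algebra S)"
      using measurable_space[OF return_measurable s] .
    then show ?thesis using 0 by (simp add: chain_step_def[abs_def])
  next
    case (Suc m)
    have "(\<lambda>\<omega>. \<omega> m) \<in> measurable (PiM {0..<n} (\<lambda>_. S)) S"
      by (rule measurable_component_singleton) (simp add: Suc)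
    from measurable_compose[OF this K'] show ?thesis
      by (simp add: Suc chain_step_def[abs_def])
  qed
next
  fix n and \<omega> :: "nat \<Rightarrow> 'a" assume \<omega>: "\<omega> \<in> space (PiM {0..<n} (\<lambda>_. S))"
  show "prob_space (chain_step S K s n \<omega>)"
  proof (cases n)
    case 0
    then show ?thesis using s by (simp add: chain_step_def prob_space_return)
  next
    case (Suc m)
    then have "\<omega> m \<in> space S" using \<omega> by (auto simp: space_PiM PiE_iff)
    then have "K (\<omega> m) \<in> space (prob_algebra S)"
      using K measurable_space unfolding transition_kernel_def by metis
    then show ?thesis by (simp add: Suc chain_step_def space_prob_algebra)
  qed
qed

lemma
  assumes "transition_kernel S K" "s \<in> space S"
  shows prob_space_chain_law: "prob_space (chain_law S K s)"
    and sets_chain_law: "sets (chain_law S K s) = sets (PiM UNIV (\<lambda>_. S))"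
proof -
  interpret Ionescu_Tulcea "chain_step S K s" "\<lambda>_. S"
    using assms by (rule Ionescu_Tulcea_chain_step)
  have "emeasure PF.lim (PF.emb UNIV {} (space (PiM {} (\<lambda>_. S)))) =
        emeasure (CI {}) (space (PiM {} (\<lambda>_. S)))"
    by (rule lim) auto
  moreover have "emeasure (CI {}) (space (PiM {} (\<lambda>_. S))) = 1"
    using PF.prob_space_P[of "{}"] prob_space.emeasure_space_1[of "CI {}"]
    by (simp add: CI_def)
  moreover have "PF.emb UNIV {} (space (PiM {} (\<lambda>_. S))) = space PF.lim"
    by (auto simp: prod_emb_def space_PiM PF.space_lim restrict_def)
  ultimately show "prob_space (chain_law S K s)"
    unfolding chain_law_def by (intro prob_spaceI) simp
  show "sets (chain_law S K s) = sets (PiM UNIV (\<lambda>_. S))"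
    by (simp add: chain_law_def)
qed

definition harris_recurrent :: "'a measure \<Rightarrow> ('a \<Rightarrow> 'a measure) \<Rightarrow> bool" where
  "harris_recurrent S K \<longleftrightarrow>
     (\<exists>\<phi>. sigma_finite_measure \<phi> \<and> sets \<phi> = sets S \<and> emeasure \<phi> (space S) > 0 \<and>
        (\<forall>A\<in>sets S. emeasure \<phi> A > 0 \<longrightarrow>
           (\<forall>s\<in>space S. AE \<omega> in chain_law S K s. infinite {n. \<omega> n \<in> A})))"

definition stationary_distribution :: "'a measure \<Rightarrow> ('a \<Rightarrow> 'a measure) \<Rightarrow> 'a measure \<Rightarrow> bool" where
  "stationary_distribution S K \<pi> \<longleftrightarrow>
     prob_space \<pi> \<and> sets \<pi> = sets S \<and>
     (\<forall>A\<in>sets S. (\<integral>\<^sup>+ s. emeasure (K s) A \<partial>\<pi>) = emeasure \<pi> A)"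

definition positive_harris :: "'a measure \<Rightarrow> ('a \<Rightarrow> 'a measure) \<Rightarrow> bool" where
  "positive_harris S K \<longleftrightarrow> harris_recurrent S K \<and> (\<exists>\<pi>. stationary_distribution S K \<pi>)"

definition cyclic_decomposition ::
    "'a measure \<Rightarrow> ('a \<Rightarrow> 'a measure) \<Rightarrow> 'a measure \<Rightarrow> nat \<Rightarrow> (nat \<Rightarrow> 'a set) \<Rightarrow> bool" where
  "cyclic_decomposition S K \<pi> d D \<longleftrightarrow>
     (\<forall>i<d. D i \<in> sets S) \<and> disjoint_family_on D {..<d} \<and>
     space S - (\<Union>i<d. D i) \<in> null_sets \<pi> \<and>
     (\<forall>i<d. \<forall>s\<in>D i. emeasure (K s) (D (Suc i mod d)) = 1)"

definition aperiodic :: "'a measure \<Rightarrow> ('a \<Rightarrow> 'a measure) \<Rightarrow> 'a measure \<Rightarrow> bool" where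
  "aperiodic S K \<pi> \<longleftrightarrow> \<not> (\<exists>d\<ge>2. \<exists>D. cyclic_decomposition S K \<pi> d D)"

text \<open>\<open>M\<^sub>n = max {X\<^sub>0, \<dots>, X\<^bsub>n-1\<^esub>}\<close>, meaningful for \<open>n \<ge> 1\<close> only.\<close>

definition chain_max :: "('a \<Rightarrow> real) \<Rightarrow> nat \<Rightarrow> (nat \<Rightarrow> 'a) \<Rightarrow> real" where
  "chain_max f n \<omega> = Max ((\<lambda>j. f (\<omega> j)) ` {..<n})"

end

theory Submission
  imports Defs "HOL-Real_Asymp.Real_Asymp"
begin

text \<open>
  Write \<open>Q n x\<close> for the probability that the maximum of the first \<open>n\<close> observations is at most \<open>x\<close>
  when the chain starts from \<open>\<pi>\<close>. The claim rests on two facts about high levels \<open>x\<close>, both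
  uniform in the number \<open>n\<close> of observations.

  \<^item> The starting point is forgotten: \<open>P\<^sub>s(M\<^sub>n \<le> x) - Q n x\<close> tends to \<open>0\<close> as \<open>x\<close> tends to infinity
    (\<open>survival_forgets_start\<close>).
  \<^item> Consequently \<open>Q\<close> is asymptotically multiplicative: \<open>Q (m + n) x - Q m x * Q n x\<close> tends to \<open>0\<close>
    (\<open>stationary_survival_asymptotically_multiplicative\<close>).

  For the first fact, consider the survival probability \<open>u(s) = P\<^sub>s(M\<^sub>n \<le> x)\<close>. One step of the kernel
  \<open>K\<close> turns \<open>u\<close> into the survival probability for \<open>n + 1\<close> observations, except at points where \<open>f\<close>
  already exceeds \<open>x\<close>. So an average of \<open>u\<close> over a long window of values of \<open>n\<close> is almost harmonic.
  Harris recurrence forces bounded harmonic functions to be constant, and it does so in a strong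
  form (\<open>asymptotically_harmonic_imp_const\<close>): if \<open>0 \<le> g\<^sub>n \<le> 1\<close> and \<open>K g\<^sub>n - g\<^sub>n\<close> tends to \<open>0\<close>
  pointwise, then \<open>g\<^sub>n(s) - \<pi>(g\<^sub>n)\<close> tends to \<open>0\<close> for every single \<open>s\<close>. The window average squeezes \<open>u\<close>,
  because \<open>u\<close> decreases in \<open>n\<close> and its \<open>\<pi>\<close>-mean hardly changes over the window.

  The strong form is a compactness argument. If \<open>g\<^sub>n(s) - \<pi>(g\<^sub>n) \<ge> e\<close> along a subsequence, choose
  averages \<open>k\<^sub>n\<close> of finitely many late members of that subsequence which nearly minimise the
  \<open>L\<^sup>2\<close> norm of a probability measure dominating both \<open>\<pi>\<close> and all laws of \<open>Y\<^sub>0, Y\<^sub>1, \<dots>\<close> under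
  \<open>P\<^sub>s\<close>. The parallelogram law makes them Cauchy, a subsequence converges almost everywhere, and the
  limit \<open>h\<close> is harmonic almost everywhere for each of these laws, with \<open>h(s) - \<pi>(h) \<ge> e\<close>. But \<open>h\<close> is
  constant \<open>\<pi>\<close>-almost everywhere (\<open>harmonic_AE_const\<close>), and the chain started at \<open>s\<close> eventually
  leaves every \<open>\<pi>\<close>-null set for good (\<open>null_set_avoided\<close>), so \<open>h(s) = E\<^sub>s h(Y\<^sub>j)\<close> equals that
  constant.

  The rest is real analysis (\<open>phantom_distribution_function\<close>). Let \<open>N\<close> be the first \<open>n\<close> with
  \<open>Q n x \<le> 1/2\<close>. Asymptotic multiplicativity gives \<open>Q n x \<approx> 2\<^bsup>-n/N\<^esup>\<close> uniformly in \<open>n\<close>. The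
  step function \<open>2\<^bsup>-1/N(x)\<^esup>\<close> would serve as \<open>G\<close> at high levels were it continuous; to smooth it,
  \<open>N\<close> is replaced by the sum \<open>S x\<close> of the positive parts of \<open>Q n x - 1/2\<close>, which is continuous in \<open>x\<close> and
  asymptotically proportional to \<open>N\<close>.
\<close>

section \<open>Asymptotically multiplicative tails\<close>

text \<open>
  In the time scale \<open>t = n / N\<close> an asymptotically multiplicative family solves Cauchy's functional
  equation \<open>r(s + t) = r(s) r(t)\<close> in the limit, and \<open>r(1) = 1/2\<close> holds by the choice of \<open>N\<close> because
  the jumps are small. This fixes the limit at rational \<open>t\<close>; monotonicity makes it uniform.
\<close>

lemma approx_multiplicative_imp_geometric:
  fixes q :: "nat \<Rightarrow> nat \<Rightarrow> real" and N :: "nat \<Rightarrow> nat" and p :: "nat \<Rightarrow> real"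
  assumes anti: "\<And>k. antimono (q k)" and nonneg: "\<And>k n. 0 \<le> q k n" and q0: "\<And>k. q k 0 = 1"
    and jump: "\<And>k n. q k n - q k (Suc n) \<le> p k" and p: "p \<longlonglongrightarrow> 0"
    and mult: "\<And>m n. (\<lambda>k. q k (m k + n k) - q k (m k) * q k (n k)) \<longlonglongrightarrow> 0"
    and N: "\<And>k. q k (N k) \<le> 1/2" and N_least: "\<And>k n. n < N k \<Longrightarrow> 1/2 < q k n"
    and e: "0 < e"
  shows "\<forall>\<^sub>F k in sequentially. \<forall>n. \<bar>q k n - (1/2) powr (real n / real (N k))\<bar> \<le> e"
proof -
  have le1: "q k n \<le> 1" for k n
    using antimonoD[OF anti, of 0 n k] q0[of k] by simp
  have N_pos: "0 < N k" for k
    using N[of k] q0[of k] by (cases "N k") auto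
  define r where "r k t = q k (nat \<lfloor>t * real (N k)\<rfloor>)" for k t
  have r_nn: "0 \<le> r k t" and r_le1: "r k t \<le> 1" for k t
    by (simp_all add: r_def nonneg le1)
  have r_antimono: "r k t \<le> r k s" if "s \<le> t" for k s t
    unfolding r_def by (intro antimonoD[OF anti] nat_mono floor_mono mult_right_mono that) simp
  have r_grid: "r k (real n / real (N k)) = q k n" for k n
    using N_pos[of k] by (simp add: r_def)
  have add: "(\<lambda>k. r k (s + t) - r k s * r k t) \<longlonglongrightarrow> 0" if st: "0 \<le> s" "0 \<le> t" for s t
  proof -
    define m where "m k = nat \<lfloor>s * real (N k)\<rfloor>" for k
    define n where "n k = nat \<lfloor>t * real (N k)\<rfloor>" for k
    have "\<bar>r k (s + t) - q k (m k + n k)\<bar> \<le> p k" for k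
    proof -
      have "0 \<le> s * real (N k)" "0 \<le> t * real (N k)" using st by auto
      then have "nat \<lfloor>(s + t) * real (N k)\<rfloor> = m k + n k \<or> nat \<lfloor>(s + t) * real (N k)\<rfloor> = Suc (m k + n k)"
        unfolding m_def n_def ring_distribs by linarith
      moreover have "q k (Suc (m k + n k)) \<le> q k (m k + n k)"
        by (intro antimonoD[OF anti]) simp
      ultimately show ?thesis
        using jump[of k "m k + n k"] unfolding r_def by auto
    qed
    then have "(\<lambda>k. r k (s + t) - q k (m k + n k)) \<longlonglongrightarrow> 0"
      by (intro Lim_null_comparison[OF _ p]) auto
    from tendsto_add[OF this mult[of m n]] show ?thesis
      by (simp add: r_def m_def n_def)
  qed
  have pow: "(\<lambda>k. r k (real j * t) - r k t ^ j) \<longlonglongrightarrow> 0" if t: "0 \<le> t" for t j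
  proof (induction j)
    case 0
    show ?case by (simp add: r_def q0)
  next
    case (Suc j)
    have "(\<lambda>k. r k t * (r k (real j * t) - r k t ^ j)) \<longlonglongrightarrow> 0"
      by (rule Lim_null_comparison[OF _ tendsto_norm_zero[OF Suc.IH]])
         (auto simp: abs_mult r_nn intro!: always_eventually mult_left_le_one_le r_le1)
    from tendsto_add[OF add[of t "real j * t"] this] t show ?case
      by (simp add: algebra_simps)
  qed
  have r1: "(\<lambda>k. r k 1) \<longlonglongrightarrow> 1/2"
  proof -
    have "1/2 - p k \<le> r k 1" "r k 1 \<le> 1/2" for k
    proof -
      obtain n where n: "N k = Suc n" using N_pos[of k] by (cases "N k") auto
      have r: "r k 1 = q k (N k)" by (simp add: r_def)
      show "1/2 - p k \<le> r k 1"
        using jump[of k n] N_least[of n k] n by (simp add: r)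
      show "r k 1 \<le> 1/2" using N[of k] by (simp add: r)
    qed
    moreover have "(\<lambda>k. 1/2 - p k) \<longlonglongrightarrow> 1/2 - 0" by (intro tendsto_intros p)
    ultimately show ?thesis
      by (intro tendsto_sandwich[of "\<lambda>k. 1/2 - p k" "\<lambda>k. r k 1" _ "\<lambda>_. 1/2"] always_eventually allI) simp_all
  qed
  have frac: "(\<lambda>k. r k (real j / real d)) \<longlonglongrightarrow> (1/2) powr (real j / real d)" if d: "0 < d" for j d
  proof -
    have "(\<lambda>k. r k 1 - (r k 1 - r k (1 / real d) ^ d)) \<longlonglongrightarrow> 1/2 - 0"
      using pow[of "1 / real d" d] d by (intro tendsto_diff r1) simp
    then have "(\<lambda>k. root d (r k (1 / real d) ^ d)) \<longlonglongrightarrow> root d (1/2)"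
      by (intro tendsto_real_root) simp
    then have "(\<lambda>k. r k (1 / real d)) \<longlonglongrightarrow> root d (1/2)"
      using d by (simp add: real_root_power_cancel r_nn)
    then have "(\<lambda>k. (r k (real j / real d) - r k (1 / real d) ^ j) + r k (1 / real d) ^ j) \<longlonglongrightarrow> 0 + root d (1/2) ^ j"
      using pow[of "1 / real d" j] by (intro tendsto_intros) auto
    moreover have "root d (1/2) ^ j = (1/2) powr (real j / real d)"
    proof -
      have "root d (1/2) ^ j = ((1/2) powr (1 / real d)) powr real j"
        using d by (simp add: root_powr_inverse powr_realpow)
      then show ?thesis by (simp add: powr_powr)
    qed
    ultimately show ?thesis by simp
  qed
  \<comment> \<open>Both functions are antitone, so it suffices to compare them on a grid of mesh \<open>1 / d\<close> up to \<open>J / d\<close>,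
      where \<open>d\<close> controls the gap between grid points and \<open>J\<close> the tail.\<close>
  have "(\<lambda>d. (1/2::real) powr (1 / real d)) \<longlonglongrightarrow> 1" by real_asymp
  then have "\<forall>\<^sub>F d in sequentially. 1 - e/2 < (1/2::real) powr (1 / real d)"
    using e by (intro order_tendstoD) auto
  then have "\<forall>\<^sub>F d in sequentially. 0 < d \<and> 1 - e/2 < (1/2::real) powr (1 / real d)"
    by (intro eventually_conj eventually_gt_at_top)
  then obtain d where d: "0 < d" "1 - e/2 < (1/2::real) powr (1 / real d)"
    by (blast dest: eventually_happens'[OF sequentially_bot])
  have "(1/2::real) powr (1 / real d) < 1"
    using d(1) powr_less_mono'[of "1/2" 0 "1 / real d"] by simp
  then have "(\<lambda>J. ((1/2::real) powr (1 / real d)) ^ J) \<longlonglongrightarrow> 0"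
    by (intro LIMSEQ_realpow_zero) auto
  then have "(\<lambda>J. (1/2::real) powr (real J / real d)) \<longlonglongrightarrow> 0"
    by (simp add: powr_powr flip: powr_realpow)
  then have "\<forall>\<^sub>F J in sequentially. (1/2::real) powr (real J / real d) < e/2"
    using e by (intro order_tendstoD) auto
  then obtain J where J: "(1/2::real) powr (real J / real d) < e/2"
    by (blast dest: eventually_happens'[OF sequentially_bot])
  have "\<forall>\<^sub>F k in sequentially. \<forall>j\<in>{..J}. \<bar>r k (real j / real d) - (1/2) powr (real j / real d)\<bar> < e/2"
    using tendstoD[OF frac[OF d(1)], of "e/2"] e
    by (intro eventually_ball_finite ballI finite_atMost) (simp add: dist_real_def)
  then show ?thesis
  proof eventually_elim
    case (elim k)
    show ?case
    proof
      fix n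
      define t where "t = real n / real (N k)"
      define j where "j = nat \<lfloor>t * real d\<rfloor>"
      have t0: "0 \<le> t" by (simp add: t_def)
      have qt: "q k n = r k t" by (simp add: t_def r_grid)
      have jt: "real j / real d \<le> t" "t \<le> real (Suc j) / real d"
        using d(1) t0 by (auto simp: j_def field_simps) linarith+
      have mono: "(1/2::real) powr v \<le> (1/2) powr u" if "u \<le> v" for u v :: real
        using that by (simp add: powr_mono')
      have "\<bar>r k t - (1/2) powr t\<bar> \<le> e"
      proof (cases "j < J")
        case True
        have "(1/2::real) powr (real j / real d) - (1/2) powr (real (Suc j) / real d)
            = (1/2) powr (real j / real d) * (1 - (1/2) powr (1 / real d))"
          by (simp add: add_divide_distrib powr_add algebra_simps)
        also have "\<dots> \<le> 1 * (1 - (1/2) powr (1 / real d))"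
          using mono[of 0 "real j / real d"] mono[of 0 "1 / real d"]
          by (intro mult_right_mono) auto
        finally have gap: "(1/2::real) powr (real j / real d) - (1/2) powr (real (Suc j) / real d) \<le> e/2"
          using d(2) by simp
        have "\<bar>r k (real j / real d) - (1/2) powr (real j / real d)\<bar> < e/2"
          "\<bar>r k (real (Suc j) / real d) - (1/2) powr (real (Suc j) / real d)\<bar> < e/2"
          using elim[rule_format, of j] elim[rule_format, of "Suc j"] True by simp_all
        with gap r_antimono[OF jt(1), of k] r_antimono[OF jt(2), of k] mono[OF jt(1)] mono[OF jt(2)]
        show ?thesis unfolding abs_le_iff abs_less_iff by linarith
      next
        case False
        have "real J / real d \<le> real j / real d" using False by (intro divide_right_mono) auto
        with jt(1) have Jt: "real J / real d \<le> t" by linarith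
        have "\<bar>r k (real J / real d) - (1/2) powr (real J / real d)\<bar> < e/2"
          using elim by auto
        moreover have "0 \<le> (1/2::real) powr t" by simp
        ultimately show ?thesis
          using r_antimono[OF Jt, of k] mono[OF Jt] J r_nn[of k t]
          unfolding abs_le_iff abs_less_iff by linarith
      qed
      then show "\<bar>q k n - (1/2) powr (real n / real (N k))\<bar> \<le> e"
        by (simp add: qt) (simp add: t_def)
    qed
  qed
qed

text \<open>
  Changing the rate of an exponential tail by a factor close to one changes the tail little,
  uniformly in time: the difference is at most \<open>\<bar>\<beta> - 1\<bar> u exp (- u / 2)\<close>, and \<open>u exp (- u / 2) \<le> 2\<close>.
\<close>

lemma exp_rate_perturbation:
  fixes \<beta> u :: real
  assumes \<beta>: "1/2 \<le> \<beta>" and u: "0 \<le> u"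
  shows "\<bar>exp (- (\<beta> * u)) - exp (- u)\<bar> \<le> 2 * \<bar>\<beta> - 1\<bar>"
proof -
  have key: "exp (- a * u) - exp (- b * u) \<le> 2 * (b - a)" if "1/2 \<le> a" "a \<le> b" for a b
  proof -
    have "exp (- a * u) - exp (- b * u) = exp (- a * u) * (1 - exp (- ((b - a) * u)))"
      by (simp add: algebra_simps flip: exp_add)
    also have "\<dots> \<le> exp (- u / 2) * ((b - a) * u)"
    proof (intro mult_mono)
      show "exp (- a * u) \<le> exp (- u / 2)"
        using mult_right_mono[OF that(1) u] by simp
      show "1 - exp (- ((b - a) * u)) \<le> (b - a) * u"
        using exp_ge_add_one_self[of "- ((b - a) * u)"] by simp
      show "0 \<le> 1 - exp (- ((b - a) * u))" using that u by simp
    qed simp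
    also have "\<dots> = (b - a) * (u * exp (- u / 2))" by simp
    also have "\<dots> \<le> (b - a) * 2"
    proof (intro mult_left_mono)
      have "u / 2 \<le> exp (u / 2)" using exp_ge_add_one_self[of "u / 2"] by linarith
      then show "u * exp (- u / 2) \<le> 2" by (simp add: exp_minus field_simps)
    qed (use that in simp)
    finally show ?thesis by simp
  qed
  show ?thesis
  proof (cases "\<beta> \<le> 1")
    case True
    with key[of \<beta> 1] \<beta> mult_right_mono[OF True u] show ?thesis by (simp add: abs_if)
  next
    case False
    with key[of 1 \<beta>] u mult_right_mono[of 1 \<beta> u] show ?thesis by (simp add: abs_if)
  qed
qed

text \<open>
  With \<open>q = Q n x\<close> close to \<open>2\<^bsup>-n/N\<^esup>\<close>, the sum \<open>S x\<close> is close to \<open>N\<close> times the integral over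
  \<open>[0, 1]\<close> of \<open>2\<^bsup>-t\<^esup> - 1/2\<close>, that is, to \<open>N * \<kappa> / ln 2\<close> with \<open>\<kappa> = (1 - ln 2) / 2\<close>. Hence
  \<open>(S / (S + \<kappa>))\<^sup>n \<approx> exp (- n \<kappa> / S) \<approx> 2\<^bsup>-n/N\<^esup>\<close>. The quotient \<open>S / (S + \<kappa>)\<close> is preferred to
  \<open>exp (- \<kappa> / S)\<close> because it stays continuous where \<open>S\<close> vanishes.
\<close>

lemma phantom_distribution_function:
  fixes Q :: "nat \<Rightarrow> real \<Rightarrow> real"
  assumes anti: "\<And>x. antimono (\<lambda>n. Q n x)" and mono: "\<And>n. mono (Q n)"
    and nonneg: "\<And>n x. 0 \<le> Q n x" and Q0: "\<And>x. Q 0 x = 1"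
    and cont: "\<And>n. continuous_on UNIV (Q n)"
    and top: "\<And>n. (Q n \<longlongrightarrow> 1) at_top" and bot: "(Q 1 \<longlongrightarrow> 0) at_bot"
    and lim: "\<And>x. (\<lambda>n. Q n x) \<longlonglongrightarrow> 0"
    and jump: "\<And>n x. Q n x - Q (Suc n) x \<le> 1 - Q 1 x"
    and mult: "\<And>X m n. filterlim X at_top sequentially \<Longrightarrow>
      (\<lambda>k. Q (m k + n k) (X k) - Q (m k) (X k) * Q (n k) (X k)) \<longlonglongrightarrow> 0"
  obtains G where "mono G" "continuous_on UNIV G" "(G \<longlongrightarrow> 0) at_bot" "(G \<longlongrightarrow> 1) at_top"
    "\<And>x. 0 \<le> G x" "\<And>x. G x < 1"
    "\<And>X n. filterlim X at_top sequentially \<Longrightarrow> (\<lambda>k. Q (n k) (X k) - G (X k) ^ n k) \<longlonglongrightarrow> 0"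
proof -
  define S where "S x = (\<Sum>n. max (Q (Suc n) x - 1/2) 0)" for x
  define \<kappa> :: real where "\<kappa> = (1 - ln 2) / 2"
  define G where "G x = S x / (S x + \<kappa>)" for x
  have \<kappa>: "0 < \<kappa>"
    using ln_add_one_self_less_self[of "1::real"] by (simp add: \<kappa>_def)
  have level: "\<exists>M. Q M x \<le> 1/2" for x
    using order_tendstoD(2)[OF lim[of x], of "1/2"] by (auto simp: eventually_sequentially intro: less_imp_le)
  have S_eq: "S x = (\<Sum>n<M. max (Q (Suc n) x - 1/2) 0)" if "Q M x \<le> 1/2" for x M
    unfolding S_def
  proof (intro suminf_finite)
    fix n assume "n \<notin> {..<M}"
    then have "Q (Suc n) x \<le> Q M x" by (intro antimonoD[OF anti]) simp
    with that show "max (Q (Suc n) x - 1/2) 0 = 0" by simp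
  qed simp
  have S_nonneg: "0 \<le> S x" for x
    using level[of x] by (auto simp: S_eq intro!: sum_nonneg)
  have S_mono: "S x \<le> S y" if "x \<le> y" for x y
  proof -
    obtain M where M: "Q M y \<le> 1/2" using level by blast
    have le: "Q n x \<le> Q n y" for n using mono that by (rule monoD)
    have "Q M x \<le> 1/2" using M le[of M] by simp
    then show ?thesis
      using M by (simp add: S_eq) (intro sum_mono max.mono diff_right_mono le order_refl)
  qed
  have S_cont: "isCont S x" for x
  proof -
    obtain M where M: "Q M (x + 1) \<le> 1/2" using level by blast
    have "S y = (\<Sum>n<M. max (Q (Suc n) y - 1/2) 0)" if "y < x + 1" for y
      using that M monoD[OF mono, of y "x + 1" M] by (intro S_eq) simp
    then have "\<forall>\<^sub>F y in nhds x. S y = (\<Sum>n<M. max (Q (Suc n) y - 1/2) 0)"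
      by (intro eventually_mono[OF eventually_nhds_in_open[of "{..<x+1}"]]) auto
    moreover have "isCont (\<lambda>y. \<Sum>n<M. max (Q (Suc n) y - 1/2) 0) x"
      using cont by (intro continuous_intros) (auto simp: continuous_on_eq_continuous_at)
    ultimately show ?thesis by (rule isCont_cong[THEN iffD2])
  qed
  have S_bot: "\<forall>\<^sub>F x in at_bot. S x = 0"
  proof -
    have "\<forall>\<^sub>F x in at_bot. Q 1 x < 1/2" using bot by (intro order_tendstoD) auto
    then show ?thesis by eventually_elim (simp add: S_eq[where M = 1])
  qed
  have S_top: "filterlim S at_top at_top"
    unfolding filterlim_at_top
  proof
    fix Z :: real
    obtain m :: nat where m: "4 * Z \<le> real m" using real_arch_simple by blast
    have "\<forall>\<^sub>F x in at_top. 3/4 < Q m x" using top by (intro order_tendstoD) auto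
    then show "\<forall>\<^sub>F x in at_top. Z \<le> S x"
    proof eventually_elim
      case (elim x)
      obtain M where M: "Q M x \<le> 1/2" using level by blast
      have "m \<le> M"
        using antimonoD[OF anti, of M m x] M elim by (cases "m \<le> M") auto
      have "Z \<le> (\<Sum>n<m. 1/4)" using m by simp
      also have "\<dots> \<le> (\<Sum>n<m. max (Q (Suc n) x - 1/2) 0)"
      proof (rule sum_mono)
        fix n assume "n \<in> {..<m}"
        then have "Q m x \<le> Q (Suc n) x" by (intro antimonoD[OF anti]) simp
        with elim show "1/4 \<le> max (Q (Suc n) x - 1/2) 0" by simp
      qed
      also have "\<dots> \<le> (\<Sum>n<M. max (Q (Suc n) x - 1/2) 0)"
        using \<open>m \<le> M\<close> by (intro sum_mono2) auto
      finally show ?case using M by (simp add: S_eq)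
    qed
  qed
  show thesis
  proof
    show "mono G"
    proof (rule monoI)
      fix x y :: real assume "x \<le> y"
      then show "G x \<le> G y"
        using S_mono[of x y] S_nonneg[of x] S_nonneg[of y] \<kappa>
        by (simp add: G_def divide_le_eq le_divide_eq field_simps add_nonneg_pos mult_right_mono)
    qed
    show "0 \<le> G x" "G x < 1" for x
      using S_nonneg[of x] \<kappa> by (simp_all add: G_def)
    show "continuous_on UNIV G"
      unfolding G_def
    proof (intro continuous_intros)
      show "continuous_on UNIV S" using S_cont by (simp add: continuous_on_eq_continuous_at)
      then show "continuous_on UNIV S" .
      show "\<forall>x\<in>UNIV. S x + \<kappa> \<noteq> 0" using S_nonneg \<kappa> by (metis add_nonneg_pos less_irrefl)
    qed
    show "(G \<longlongrightarrow> 0) at_bot"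
      using S_bot by (intro tendsto_eventually) (auto elim!: eventually_mono simp: G_def)
    have "((\<lambda>s. s / (s + \<kappa>)) \<longlongrightarrow> 1) at_top" using \<kappa> by real_asymp
    from filterlim_compose[OF this S_top] show "(G \<longlongrightarrow> 1) at_top"
      by (simp add: G_def[abs_def])
    fix X :: "nat \<Rightarrow> real" and n :: "nat \<Rightarrow> nat"
    assume X: "filterlim X at_top sequentially"
    define N where "N k = (LEAST n. Q n (X k) \<le> 1/2)" for k
    have N: "Q (N k) (X k) \<le> 1/2" for k
      unfolding N_def by (rule LeastI_ex) (rule level)
    have N_least: "1/2 < Q n (X k)" if "n < N k" for n k
      using not_less_Least[OF that[unfolded N_def]] by simp
    have N_pos: "0 < N k" for k using N[of k] Q0[of "X k"] by (cases "N k") auto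
    have N_top: "filterlim N at_top sequentially"
      unfolding filterlim_at_top
    proof
      fix m
      have "\<forall>\<^sub>F k in sequentially. 1/2 < Q m (X k)"
        using filterlim_compose[OF top X] by (intro order_tendstoD) auto
      then show "\<forall>\<^sub>F k in sequentially. m \<le> N k"
      proof eventually_elim
        case (elim k)
        with N[of k] antimonoD[OF anti, of "N k" m "X k"] show ?case by (cases "m \<le> N k") auto
      qed
    qed
    have "(\<lambda>k. 1 - Q 1 (X k)) \<longlonglongrightarrow> 1 - 1"
      by (intro tendsto_intros filterlim_compose[OF top X])
    then have geom: "\<forall>\<^sub>F k in sequentially. \<forall>n. \<bar>Q n (X k) - (1/2) powr (real n / real (N k))\<bar> \<le> e" if "0 < e" for e
      using that anti nonneg Q0 jump mult[OF X] N N_least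
      by (intro approx_multiplicative_imp_geometric[where q = "\<lambda>k n. Q n (X k)" and p = "\<lambda>k. 1 - Q 1 (X k)"]) auto
    \<comment> \<open>\<open>T N\<close> is what \<open>S\<close> would be for exactly geometric tails.\<close>
    define T where "T N = (\<Sum>n<N. (1/2) powr (real (Suc n) / real N) - (1/2::real))" for N
    have T: "(\<lambda>k. T (N k) / real (N k)) \<longlonglongrightarrow> \<kappa> / ln 2"
    proof -
      define a :: "nat \<Rightarrow> real" where "a N = (1/2) powr (1 / real N)" for N
      have "T N = a N / (2 * (1 - a N)) - real N / 2" if "0 < N" for N
      proof -
        have a: "a N < 1" "a N ^ N = 1/2"
          using powr_less_mono'[of "1/2" 0 "1 / real N"] that
          by (simp_all add: a_def powr_powr flip: powr_realpow)
        have "(1/2) powr (real (Suc n) / real N) = a N * a N ^ n" for n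
        proof -
          have "a N * a N ^ n = a N ^ Suc n" by simp
          also have "\<dots> = a N powr real (Suc n)" by (subst powr_realpow) (auto simp: a_def)
          finally show ?thesis by (simp add: a_def powr_powr)
        qed
        then have "T N = (\<Sum>n<N. a N * a N ^ n) - real N / 2"
          by (simp add: T_def sum_subtractf)
        also have "(\<Sum>n<N. a N * a N ^ n) = a N * ((1 - a N ^ N) / (1 - a N))"
          using a by (simp add: sum_gp_strict flip: sum_distrib_left)
        finally show ?thesis using a by simp
      qed
      note aT = this
      have "(\<lambda>N. (a N / (2 * (1 - a N)) - real N / 2) / real N) \<longlonglongrightarrow> - (inverse (ln (1/2)) / 2) - 1/2"
        unfolding a_def by real_asymp
      then have "(\<lambda>N. (a N / (2 * (1 - a N)) - real N / 2) / real N) \<longlonglongrightarrow> \<kappa> / ln 2"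
        by (simp add: \<kappa>_def ln_div field_simps)
      from filterlim_compose[OF this N_top] show ?thesis
        by (rule tendsto_cong[THEN iffD1, rotated]) (use aT N_pos in simp)
    qed
    have "(\<lambda>k. S (X k) / real (N k) - T (N k) / real (N k)) \<longlonglongrightarrow> 0"
    proof (rule tendstoI)
      fix e :: real assume "0 < e"
      then have "\<forall>\<^sub>F k in sequentially. \<forall>n. \<bar>Q n (X k) - (1/2) powr (real n / real (N k))\<bar> \<le> e/2"
        by (intro geom) simp
      then show "\<forall>\<^sub>F k in sequentially. dist (S (X k) / real (N k) - T (N k) / real (N k)) 0 < e"
      proof eventually_elim
        case (elim k)
        have "\<bar>max (Q (Suc n) (X k) - 1/2) 0 - ((1/2) powr (real (Suc n) / real (N k)) - 1/2)\<bar> \<le> e/2"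
          if "n < N k" for n
        proof -
          have "(1/2::real) powr 1 \<le> (1/2) powr (real (Suc n) / real (N k))"
            using that by (intro powr_mono') auto
          with elim[rule_format, of "Suc n"] show ?thesis by (auto simp: abs_le_iff max_def)
        qed
        then have "\<bar>S (X k) - T (N k)\<bar> \<le> (\<Sum>n<N k. e/2)"
          unfolding S_eq[OF N] T_def sum_subtractf[symmetric]
          by (intro order_trans[OF sum_abs] sum_mono) auto
        then have "\<bar>(S (X k) - T (N k)) / real (N k)\<bar> \<le> e/2"
          using N_pos[of k] by (simp add: divide_le_eq mult.commute)
        with \<open>0 < e\<close> show ?case by (simp add: diff_divide_distrib)
      qed
    qed
    from tendsto_add[OF this T] have SN: "(\<lambda>k. S (X k) / real (N k)) \<longlonglongrightarrow> \<kappa> / ln 2" by simp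
    have SX: "filterlim (\<lambda>k. S (X k)) at_top sequentially"
      by (rule filterlim_compose[OF S_top X])
    \<comment> \<open>\<open>G (X k)\<close> is the \<open>\<beta> k\<close>-th power of \<open>2\<^bsup>-1/N k\<^esup>\<close>.\<close>
    define \<beta> where "\<beta> k = real (N k) * ln (1 + \<kappa> / S (X k)) / ln 2" for k
    have \<beta>: "\<beta> \<longlonglongrightarrow> 1"
    proof -
      have "((\<lambda>s. s * ln (1 + \<kappa> / s)) \<longlongrightarrow> \<kappa>) at_top" using \<kappa> by real_asymp
      from filterlim_compose[OF this SX]
      have "(\<lambda>k. S (X k) * ln (1 + \<kappa> / S (X k)) / (S (X k) / real (N k)) / ln 2) \<longlonglongrightarrow> \<kappa> / (\<kappa> / ln 2) / ln 2"
        using \<kappa> by (intro tendsto_divide SN tendsto_const) auto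
      moreover have "\<forall>\<^sub>F k in sequentially.
          S (X k) * ln (1 + \<kappa> / S (X k)) / (S (X k) / real (N k)) / ln 2 = \<beta> k"
        using filterlim_at_top_dense[THEN iffD1, OF SX, rule_format, of 0]
        by eventually_elim (simp add: \<beta>_def)
      ultimately show ?thesis using \<kappa> by (simp add: tendsto_cong)
    qed
    have "(\<lambda>k. 2 * \<bar>\<beta> k - 1\<bar>) \<longlonglongrightarrow> 2 * \<bar>1 - 1\<bar>" by (intro tendsto_intros \<beta>)
    then have \<beta>0: "(\<lambda>k. 2 * \<bar>\<beta> k - 1\<bar>) \<longlonglongrightarrow> 0" by simp
    have ev: "\<forall>\<^sub>F k in sequentially. norm (G (X k) ^ n k - (1/2) powr (real (n k) / real (N k))) \<le> 2 * \<bar>\<beta> k - 1\<bar>"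
    proof -
      have "\<forall>\<^sub>F k in sequentially. 0 < S (X k)" "\<forall>\<^sub>F k in sequentially. 1/2 < \<beta> k"
        using filterlim_at_top_dense[THEN iffD1, OF SX] order_tendstoD(1)[OF \<beta>, of "1/2"] by auto
      then show ?thesis
      proof eventually_elim
        case (elim k)
        have u: "0 \<le> real (n k) / real (N k) * ln 2" by simp
        have "G (X k) = inverse (1 + \<kappa> / S (X k))"
          using elim(1) \<kappa> by (simp add: G_def field_simps)
        also have "\<dots> = exp (- ln (1 + \<kappa> / S (X k)))"
          using elim(1) \<kappa> by (simp add: exp_minus add_pos_pos)
        finally have "G (X k) ^ n k = exp (real (n k) * (- ln (1 + \<kappa> / S (X k))))"
          by (simp only: exp_of_nat_mult)
        also have "real (n k) * (- ln (1 + \<kappa> / S (X k))) = - (\<beta> k * (real (n k) / real (N k) * ln 2))"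
          using N_pos[of k] by (simp add: \<beta>_def)
        finally have "G (X k) ^ n k = exp (- (\<beta> k * (real (n k) / real (N k) * ln 2)))" .
        moreover have "(1/2) powr (real (n k) / real (N k)) = exp (- (real (n k) / real (N k) * ln 2))"
          by (simp add: powr_def ln_div)
        ultimately show ?case
          using exp_rate_perturbation[OF _ u, of "\<beta> k"] elim(2) by simp
      qed
    qed
    have "(\<lambda>k. G (X k) ^ n k - (1/2) powr (real (n k) / real (N k))) \<longlonglongrightarrow> 0"
      by (rule Lim_null_comparison[OF ev \<beta>0])
    moreover have "(\<lambda>k. Q (n k) (X k) - (1/2) powr (real (n k) / real (N k))) \<longlonglongrightarrow> 0"
    proof (rule tendstoI)
      fix e :: real assume "0 < e"
      then have "\<forall>\<^sub>F k in sequentially. \<forall>n. \<bar>Q n (X k) - (1/2) powr (real n / real (N k))\<bar> \<le> e/2"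
        by (intro geom) simp
      then show "\<forall>\<^sub>F k in sequentially. dist (Q (n k) (X k) - (1/2) powr (real (n k) / real (N k))) 0 < e"
      proof eventually_elim
        case (elim k)
        from elim[rule_format, of "n k"] \<open>0 < e\<close> show ?case by simp
      qed
    qed
    ultimately show "(\<lambda>k. Q (n k) (X k) - G (X k) ^ n k) \<longlonglongrightarrow> 0"
      using tendsto_diff by fastforce
  qed
qed

section \<open>Markov kernels and survival probabilities\<close>

definition kernel_op :: "('a \<Rightarrow> 'a measure) \<Rightarrow> ('a \<Rightarrow> real) \<Rightarrow> 'a \<Rightarrow> real" where
  "kernel_op K g s = (\<integral>y. g y \<partial>K s)"

primrec marginal :: "'a measure \<Rightarrow> ('a \<Rightarrow> 'a measure) \<Rightarrow> 'a \<Rightarrow> nat \<Rightarrow> 'a measure" where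
  "marginal S K s 0 = return S s"
| "marginal S K s (Suc n) = marginal S K s n \<bind> K"

text \<open>
  The probability that \<open>Y\<^sub>0, \<dots>, Y\<^bsub>n-1\<^esub>\<close> all lie in \<open>B\<close>, by first-step decomposition
  (see \<open>chain_law_stays\<close>).
\<close>

primrec survival :: "('a \<Rightarrow> 'a measure) \<Rightarrow> 'a set \<Rightarrow> nat \<Rightarrow> 'a \<Rightarrow> real" where
  "survival K B 0 s = 1"
| "survival K B (Suc n) s = indicator B s * kernel_op K (survival K B n) s"

text \<open>
  All functions below are probabilities or differences of probabilities; the bounds make them
  integrable for every probability measure at once.
\<close>

definition unit_valued :: "'a measure \<Rightarrow> ('a \<Rightarrow> real) \<Rightarrow> bool" where
  "unit_valued S g \<longleftrightarrow> g \<in> borel_measurable S \<and> (\<forall>y\<in>space S. 0 \<le> g y \<and> g y \<le> 1)"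

lemma unit_valuedI:
  "g \<in> borel_measurable S \<Longrightarrow> (\<And>y. y \<in> space S \<Longrightarrow> 0 \<le> g y) \<Longrightarrow> (\<And>y. y \<in> space S \<Longrightarrow> g y \<le> 1) \<Longrightarrow> unit_valued S g"
  by (simp add: unit_valued_def)

lemma unit_valuedD:
  assumes "unit_valued S g"
  shows "g \<in> borel_measurable S" "y \<in> space S \<Longrightarrow> 0 \<le> g y" "y \<in> space S \<Longrightarrow> g y \<le> 1"
  using assms by (auto simp: unit_valued_def)

lemma unit_valued_integrable:
  assumes g: "unit_valued S g" and M: "prob_space M" "sets M = sets S"
  shows "integrable M g"
proof -
  interpret prob_space M by fact
  have "space M = space S" using M(2) by (rule sets_eq_imp_space_eq)
  with g M show ?thesis
    by (intro integrable_const_bound[where B = 1] AE_I2)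
       (auto simp: unit_valued_def measurable_cong_sets[OF M(2) refl])
qed

lemma unit_valued_integral:
  assumes g: "unit_valued S g" and M: "prob_space M" "sets M = sets S"
  shows "0 \<le> (\<integral>y. g y \<partial>M)" "(\<integral>y. g y \<partial>M) \<le> 1"
proof -
  interpret prob_space M by fact
  have "space M = space S" using M(2) by (rule sets_eq_imp_space_eq)
  then show "0 \<le> (\<integral>y. g y \<partial>M)" "(\<integral>y. g y \<partial>M) \<le> 1"
    using unit_valuedD(2,3)[OF g] unit_valued_integrable[OF g M]
    by (auto intro!: integral_le_const AE_I2 Bochner_Integration.integral_nonneg)
qed

lemma unit_valued_1_minus: "unit_valued S g \<Longrightarrow> unit_valued S (\<lambda>y. 1 - g y)"
  by (auto simp: unit_valued_def)

lemma unit_valued_mult: "unit_valued S g \<Longrightarrow> unit_valued S h \<Longrightarrow> unit_valued S (\<lambda>y. g y * h y)"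
  by (auto simp: unit_valued_def mult_le_one)

lemma unit_valued_midpoint: "unit_valued S g \<Longrightarrow> unit_valued S h \<Longrightarrow> unit_valued S (\<lambda>y. (g y + h y) / 2)"
  by (force simp: unit_valued_def)

lemma unit_valued_abs_diff: "unit_valued S g \<Longrightarrow> unit_valued S h \<Longrightarrow> unit_valued S (\<lambda>y. \<bar>g y - h y\<bar>)"
  unfolding unit_valued_def by (auto simp: abs_le_iff) (smt (verit))+

lemma unit_valued_const: "0 \<le> c \<Longrightarrow> c \<le> 1 \<Longrightarrow> unit_valued S (\<lambda>_. c)"
  by (auto simp: unit_valued_def)

lemma unit_valued_indicator: "A \<in> sets S \<Longrightarrow> unit_valued S (indicator A)"
  by (auto simp: unit_valued_def)

locale markov_kernel =
  fixes S :: "'a measure" and K :: "'a \<Rightarrow> 'a measure"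
  assumes kernel: "transition_kernel S K"
begin

lemma measurable_K[measurable]: "K \<in> measurable S (subprob_algebra S)"
  using kernel unfolding transition_kernel_def by (rule measurable_prob_algebraD)

lemma
  assumes "s \<in> space S"
  shows prob_space_K: "prob_space (K s)" and sets_K: "sets (K s) = sets S" and space_K: "space (K s) = space S"
proof -
  have "K s \<in> space (prob_algebra S)"
    using kernel assms measurable_space unfolding transition_kernel_def by metis
  then show "prob_space (K s)" and "sets (K s) = sets S"
    by (auto simp: space_prob_algebra)
  then show "space (K s) = space S" by (intro sets_eq_imp_space_eq)
qed

lemma measurable_bind_K: "sets M = sets S \<Longrightarrow> K \<in> measurable M (subprob_algebra S)"
  using measurable_K measurable_cong_sets[of M S] by blast

lemma
  assumes M: "prob_space M" "sets M = sets S"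
  shows prob_space_bind_K: "prob_space (M \<bind> K)" and sets_bind_K: "sets (M \<bind> K) = sets S"
proof -
  have sp: "space M = space S" using M(2) by (rule sets_eq_imp_space_eq)
  show "prob_space (M \<bind> K)"
    by (rule prob_space.prob_space_bind[OF M(1) AE_I2 measurable_bind_K[OF M(2)]]) (simp add: sp prob_space_K)
  show "sets (M \<bind> K) = sets S"
    using sp prob_space.not_empty[OF M(1)] sets_K by (intro sets_bind) auto
qed

lemma unit_valued_kernel_op:
  assumes g: "unit_valued S g"
  shows "unit_valued S (kernel_op K g)"
proof (rule unit_valuedI)
  have [measurable]: "g \<in> borel_measurable S" by (rule unit_valuedD[OF g])
  show "kernel_op K g \<in> borel_measurable S"
    unfolding kernel_op_def[abs_def]
    by (rule measurable_compose[OF measurable_K integral_measurable_subprob_algebra]) simp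
  show "0 \<le> kernel_op K g y" "kernel_op K g y \<le> 1" if "y \<in> space S" for y
    unfolding kernel_op_def by (intro unit_valued_integral[OF g] prob_space_K sets_K that)+
qed

lemma integrable_K: "unit_valued S g \<Longrightarrow> s \<in> space S \<Longrightarrow> integrable (K s) g"
  by (rule unit_valued_integrable[OF _ prob_space_K sets_K])

lemma integral_bind_K:
  assumes g: "unit_valued S g" and M: "prob_space M" "sets M = sets S"
  shows "(\<integral>y. g y \<partial>(M \<bind> K)) = (\<integral>y. kernel_op K g y \<partial>M)"
proof -
  have sp: "space M = space S" using M(2) by (rule sets_eq_imp_space_eq)
  have spb: "space (M \<bind> K) = space S" using sets_bind_K[OF M] by (rule sets_eq_imp_space_eq)
  note op = unit_valued_kernel_op[OF g]
  have "ennreal (\<integral>y. g y \<partial>(M \<bind> K)) = (\<integral>\<^sup>+y. ennreal (g y) \<partial>(M \<bind> K))"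
    using unit_valuedD(2)[OF g] spb
    by (intro nn_integral_eq_integral[symmetric] unit_valued_integrable[OF g prob_space_bind_K[OF M] sets_bind_K[OF M]] AE_I2) auto
  also have "\<dots> = (\<integral>\<^sup>+s. \<integral>\<^sup>+y. ennreal (g y) \<partial>K s \<partial>M)"
    using unit_valuedD(1)[OF g] by (intro nn_integral_bind[OF _ measurable_bind_K[OF M(2)]]) simp
  also have "\<dots> = (\<integral>\<^sup>+s. ennreal (kernel_op K g s) \<partial>M)"
    unfolding kernel_op_def using unit_valuedD(2)[OF g] sp space_K
    by (intro nn_integral_cong nn_integral_eq_integral integrable_K[OF g] AE_I2) auto
  also have "\<dots> = ennreal (\<integral>s. kernel_op K g s \<partial>M)"
    using unit_valuedD(2)[OF op] sp
    by (intro nn_integral_eq_integral unit_valued_integrable[OF op M] AE_I2) auto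
  finally show ?thesis
    using unit_valued_integral(1)[OF g prob_space_bind_K[OF M] sets_bind_K[OF M]] unit_valued_integral(1)[OF op M]
    by simp
qed

lemma AE_bind_K:
  assumes "sets M = sets S" "Measurable.pred S P" "AE y in M \<bind> K. P y"
  shows "AE s in M. AE y in K s. P y"
  using AE_bind[OF measurable_bind_K[OF assms(1)] assms(2)] assms(3) by simp

lemma
  assumes s: "s \<in> space S"
  shows prob_space_marginal: "prob_space (marginal S K s n)"
    and sets_marginal: "sets (marginal S K s n) = sets S"
proof -
  have "prob_space (marginal S K s n) \<and> sets (marginal S K s n) = sets S"
    by (induction n) (simp_all add: s prob_space_return prob_space_bind_K sets_bind_K)
  then show "prob_space (marginal S K s n)" "sets (marginal S K s n) = sets S" by auto
qed

lemma space_marginal: "s \<in> space S \<Longrightarrow> space (marginal S K s n) = space S"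
  by (intro sets_eq_imp_space_eq sets_marginal)

lemma kernel_op_mono:
  assumes "unit_valued S g" "unit_valued S h" "s \<in> space S" "\<And>y. y \<in> space S \<Longrightarrow> g y \<le> h y"
  shows "kernel_op K g s \<le> kernel_op K h s"
  unfolding kernel_op_def using assms by (intro integral_mono integrable_K) (auto simp: space_K)

lemma kernel_op_const: "s \<in> space S \<Longrightarrow> kernel_op K (\<lambda>_. c) s = c"
  using prob_space.prob_space[OF prob_space_K] by (simp add: kernel_op_def)

lemma kernel_op_1_minus:
  assumes "unit_valued S g" "s \<in> space S"
  shows "kernel_op K (\<lambda>y. 1 - g y) s = 1 - kernel_op K g s"
proof -
  interpret prob_space "K s" using assms(2) by (rule prob_space_K)
  show ?thesis
    using integrable_K[OF assms] by (simp add: kernel_op_def prob_space)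
qed

lemma kernel_op_midpoint:
  assumes "unit_valued S g" "unit_valued S h" "s \<in> space S"
  shows "kernel_op K (\<lambda>y. (g y + h y) / 2) s = (kernel_op K g s + kernel_op K h s) / 2"
  using integrable_K[OF assms(1,3)] integrable_K[OF assms(2,3)] by (simp add: kernel_op_def)

lemma kernel_op_AE_eq_1:
  assumes "unit_valued S g" "s \<in> space S" "AE y in K s. g y = 1"
  shows "kernel_op K g s = 1"
proof -
  have "kernel_op K g s = (\<integral>y. 1 \<partial>K s)"
    unfolding kernel_op_def using assms unit_valuedD(1)[OF assms(1)]
    by (intro integral_cong_AE) (auto simp: measurable_cong_sets[OF sets_K refl])
  then show ?thesis using prob_space.prob_space[OF prob_space_K[OF assms(2)]] by simp
qed

lemma unit_valued_survival: "B \<in> sets S \<Longrightarrow> unit_valued S (survival K B n)"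
proof (induction n)
  case 0
  show ?case by (simp add: unit_valued_def)
next
  case (Suc n)
  have "survival K B (Suc n) = (\<lambda>s. indicator B s * kernel_op K (survival K B n) s)"
    by (simp add: fun_eq_iff)
  then show ?case
    using unit_valued_mult[OF unit_valued_indicator[OF Suc.prems] unit_valued_kernel_op[OF Suc.IH[OF Suc.prems]]]
    by simp
qed

lemma survival_Suc_le:
  assumes B: "B \<in> sets S" and s: "s \<in> space S"
  shows "survival K B (Suc n) s \<le> survival K B n s"
  using s
proof (induction n arbitrary: s)
  case 0
  then show ?case using unit_valuedD(3)[OF unit_valued_survival[OF B], of s 1] by simp
next
  case (Suc n)
  then have "kernel_op K (survival K B (Suc n)) s \<le> kernel_op K (survival K B n) s"
    by (intro kernel_op_mono unit_valued_survival B) auto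
  then show ?case
    unfolding survival.simps(2)[of K B "Suc n"] survival.simps(2)[of K B n] by (rule mult_left_mono) simp
qed

lemma survival_antimono: "B \<in> sets S \<Longrightarrow> s \<in> space S \<Longrightarrow> antimono (\<lambda>n. survival K B n s)"
  by (rule decseq_SucI) (rule survival_Suc_le)

lemma survival_mono_set:
  assumes "A \<in> sets S" "B \<in> sets S" "A \<subseteq> B" "s \<in> space S"
  shows "survival K A n s \<le> survival K B n s"
  using assms(4)
proof (induction n arbitrary: s)
  case (Suc n)
  have "kernel_op K (survival K A n) s \<le> kernel_op K (survival K B n) s"
    using Suc assms by (intro kernel_op_mono unit_valued_survival) auto
  moreover have "0 \<le> kernel_op K (survival K A n) s"
    using unit_valuedD(2)[OF unit_valued_kernel_op[OF unit_valued_survival[OF assms(1)]]] Suc.prems .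
  ultimately show ?case using assms(3) by (auto simp: indicator_def)
qed simp

lemma unit_valued_funpow: "unit_valued S g \<Longrightarrow> unit_valued S ((kernel_op K ^^ n) g)"
  by (induction n) (auto intro: unit_valued_kernel_op)

lemma marginal_eq_funpow:
  assumes s: "s \<in> space S" and g: "unit_valued S g"
  shows "(\<integral>y. g y \<partial>marginal S K s n) = (kernel_op K ^^ n) g s"
  using g
proof (induction n arbitrary: g)
  case 0
  then show ?case using s unit_valuedD(1)[OF 0] by (simp add: integral_return)
next
  case (Suc n)
  show ?case
    using Suc.IH[OF unit_valued_kernel_op[OF Suc.prems]]
    by (simp add: integral_bind_K[OF Suc.prems prob_space_marginal[OF s] sets_marginal[OF s]] funpow_swap1)
qed

end

context markov_kernel
begin

lemma kernel_op_abs_diff: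
  assumes g: "unit_valued S g" and h: "unit_valued S h" and s: "s \<in> space S"
  shows "\<bar>kernel_op K g s - kernel_op K h s\<bar> \<le> kernel_op K (\<lambda>y. \<bar>g y - h y\<bar>) s"
  using integral_abs_bound[of "K s" "\<lambda>y. g y - h y"] integrable_K[OF g s] integrable_K[OF h s]
  by (simp add: kernel_op_def)

text \<open>
  By the Markov property, surviving \<open>m + n\<close> steps means surviving \<open>m\<close> steps and then \<open>n\<close> more from
  \<open>Y\<^sub>m\<close>. Replacing the second factor by a constant costs at most its mean deviation under the law
  of \<open>Y\<^sub>m\<close>.
\<close>

lemma survival_add_abs_diff:
  assumes B: "B \<in> sets S" and c: "0 \<le> c" "c \<le> 1" and s: "s \<in> space S"
  shows "\<bar>survival K B (m + n) s - survival K B m s * c\<bar> \<le> (kernel_op K ^^ m) (\<lambda>y. \<bar>survival K B n y - c\<bar>) s"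
  using s
proof (induction m arbitrary: s)
  case (Suc m)
  note u = unit_valued_survival[OF B]
  note uc = unit_valued_mult[OF u unit_valued_const[OF c]]
  note ud = unit_valued_abs_diff[OF u unit_valued_const[OF c]]
  have "survival K B (Suc m + n) s - survival K B (Suc m) s * c
      = indicator B s * (kernel_op K (survival K B (m + n)) s - kernel_op K (\<lambda>y. survival K B m y * c) s)"
    by (simp add: kernel_op_def algebra_simps)
  also have "\<bar>\<dots>\<bar> \<le> \<bar>kernel_op K (survival K B (m + n)) s - kernel_op K (\<lambda>y. survival K B m y * c) s\<bar>"
    by (simp add: indicator_def)
  also have "\<dots> \<le> kernel_op K (\<lambda>y. \<bar>survival K B (m + n) y - survival K B m y * c\<bar>) s"
    by (rule kernel_op_abs_diff[OF u uc Suc.prems])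
  also have "\<dots> \<le> kernel_op K ((kernel_op K ^^ m) (\<lambda>y. \<bar>survival K B n y - c\<bar>)) s"
    by (rule kernel_op_mono[OF unit_valued_abs_diff[OF u uc] unit_valued_funpow[OF ud] Suc.prems Suc.IH])
  finally show ?case by simp
qed simp

end

section \<open>Survival probabilities and the path measure\<close>

context markov_kernel
begin

text \<open>
  The path measure is built forwards, by appending the last coordinate, whereas \<open>survival\<close> peels off
  the first step. Both agree because either one iterates the operator \<open>T g = 1\<^sub>B \<cdot> K g\<close>; the forward
  induction therefore has to carry a test function \<open>g\<close> of the last coordinate.
\<close>

lemma chain_law_stays:
  assumes s: "s \<in> space S" and B[measurable]: "B \<in> sets S"
  shows "measure (chain_law S K s) {\<omega> \<in> space (chain_law S K s). \<forall>j<n. \<omega> j \<in> B} = survival K B n s"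
proof -
  interpret IT: Ionescu_Tulcea "chain_step S K s" "\<lambda>_. S"
    by (rule Ionescu_Tulcea_chain_step[OF kernel s])
  define C where "C n = IT.C 0 n (\<lambda>_. undefined)" for n
  have sets_C: "sets (C n) = sets (PiM {0..<n} (\<lambda>_. S))" for n
    using IT.sets_C[of "\<lambda>_. undefined" 0 n] by (simp add: C_def)
  then have space_C: "space (C n) = space (PiM {0..<n} (\<lambda>_. S))" for n
    by (rule sets_eq_imp_space_eq)
  have C_Suc: "(\<integral>\<^sup>+x. f x \<partial>C (Suc n)) = (\<integral>\<^sup>+x. \<integral>\<^sup>+y. f (x(n := y)) \<partial>chain_step S K s n x \<partial>C n)"
    if f: "f \<in> borel_measurable (PiM {0..<Suc n} (\<lambda>_. S))" for f n
  proof -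
    have "IT.eP n \<in> measurable (C n) (subprob_algebra (PiM {0..<Suc n} (\<lambda>_. S)))"
      using IT.measurable_eP[of n] measurable_cong_sets[OF sets_C refl] by blast
    from nn_integral_bind[OF f this]
    have "(\<integral>\<^sup>+x. f x \<partial>C (Suc n)) = (\<integral>\<^sup>+x. \<integral>\<^sup>+y. f y \<partial>IT.eP n x \<partial>C n)" by (simp add: C_def)
    also have "\<dots> = (\<integral>\<^sup>+x. \<integral>\<^sup>+y. f (x(n := y)) \<partial>chain_step S K s n x \<partial>C n)"
      by (intro nn_integral_cong IT.nn_integral_eP f) (simp add: space_C)
    finally show ?thesis .
  qed
  define T where "T g y = indicator B y * kernel_op K g y" for g y
  have T: "unit_valued S (T g)" if "unit_valued S g" for g
    unfolding T_def by (rule unit_valued_mult[OF unit_valued_indicator[OF B] unit_valued_kernel_op[OF that]])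
  have survival_T: "survival K B n = (T ^^ n) (survival K B 0)" for n
  proof (induction n)
    case (Suc n)
    have "survival K B (Suc n) = T (survival K B n)" by (simp add: fun_eq_iff T_def)
    then show ?case by (simp add: Suc.IH del: survival.simps)
  qed simp
  have meas: "(\<lambda>x. indicator {x. \<forall>j<n. x j \<in> B} x * ennreal (g (x n))) \<in> borel_measurable (PiM {0..<Suc n} (\<lambda>_. S))"
    if "unit_valued S g" for n g
  proof -
    have [measurable]: "g \<in> borel_measurable S" by (rule unit_valuedD[OF that])
    have [measurable]: "(\<lambda>x. x j) \<in> measurable (PiM {0..<Suc n} (\<lambda>_. S)) S" if "j \<le> n" for j
      using that by (intro measurable_component_singleton) auto
    have "Measurable.pred (PiM {0..<Suc n} (\<lambda>_. S)) (\<lambda>x. \<forall>j\<in>{..<n}. x j \<in> B)"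
      by (intro pred_intros_finite) (auto intro: measurable_compose[OF _ pred_sets2[OF B measurable_ident]])
    then have [measurable]: "Measurable.pred (PiM {0..<Suc n} (\<lambda>_. S)) (\<lambda>x. \<forall>j<n. x j \<in> B)"
      by (simp add: Ball_def)
    have "(\<lambda>x. (if \<forall>j<n. x j \<in> B then 1 else 0) * ennreal (g (x n))) \<in> borel_measurable (PiM {0..<Suc n} (\<lambda>_. S))"
      by measurable
    then show ?thesis by (simp add: indicator_def)
  qed
  have path: "(\<integral>\<^sup>+x. indicator {x. \<forall>j<n. x j \<in> B} x * ennreal (g (x n)) \<partial>C (Suc n)) = ennreal ((T ^^ n) g s)"
    if "unit_valued S g" for n g
    using that
  proof (induction n arbitrary: g)
    case 0
    have g[measurable]: "g \<in> borel_measurable S" by (rule unit_valuedD[OF 0])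
    have "C 0 = return (PiM {} (\<lambda>_. S)) (\<lambda>_. undefined)" by (simp add: C_def)
    moreover have "emeasure (return (PiM {} (\<lambda>_. S)) (\<lambda>_. undefined)) {\<lambda>_::nat. undefined} = 1"
      by (subst emeasure_return) (simp_all add: sets_PiM_empty)
    ultimately show ?case
      using s by (subst C_Suc[OF meas[OF 0]]) (simp add: chain_step_def nn_integral_return space_PiM)
  next
    case (Suc n)
    note g = Suc.prems
    have "(\<integral>\<^sup>+x. indicator {x. \<forall>j<Suc n. x j \<in> B} x * ennreal (g (x (Suc n))) \<partial>C (Suc (Suc n)))
      = (\<integral>\<^sup>+x. \<integral>\<^sup>+y. indicator {x. \<forall>j<Suc n. x j \<in> B} x * ennreal (g y) \<partial>K (x n) \<partial>C (Suc n))"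
      by (subst C_Suc[OF meas[OF g]])
         (auto intro!: nn_integral_cong simp: chain_step_def indicator_def)
    also have "\<dots> = (\<integral>\<^sup>+x. indicator {x. \<forall>j<n. x j \<in> B} x * ennreal (T g (x n)) \<partial>C (Suc n))"
    proof (rule nn_integral_cong)
      fix x assume "x \<in> space (C (Suc n))"
      then have x: "x n \<in> space S" by (auto simp: space_C space_PiM)
      have "(\<integral>\<^sup>+y. ennreal (g y) \<partial>K (x n)) = ennreal (kernel_op K g (x n))"
        unfolding kernel_op_def using unit_valuedD(2)[OF g] x
        by (intro nn_integral_eq_integral integrable_K[OF g] AE_I2) (auto simp: space_K)
      moreover have "g \<in> borel_measurable (K (x n))"
        using unit_valuedD(1)[OF g] measurable_cong_sets[OF sets_K[OF x] refl] by blast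
      ultimately show "(\<integral>\<^sup>+y. indicator {x. \<forall>j<Suc n. x j \<in> B} x * ennreal (g y) \<partial>K (x n))
          = indicator {x. \<forall>j<n. x j \<in> B} x * ennreal (T g (x n))"
        by (auto simp: nn_integral_cmult T_def indicator_def less_Suc_eq)
    qed
    also have "\<dots> = ennreal ((T ^^ Suc n) g s)"
      using Suc.IH[OF T[OF g]] by (simp add: funpow_swap1)
    finally show ?case .
  qed
  show ?thesis
  proof (cases n)
    case 0
    show ?thesis using prob_space.prob_space[OF prob_space_chain_law[OF kernel s]] by (simp add: 0)
  next
    case (Suc m)
    define X where "X = (\<Pi>\<^sub>E j\<in>{0..<n}. B)"
    have BS: "B \<subseteq> space S" by (rule sets.sets_into_space[OF B])
    have X[measurable]: "X \<in> sets (PiM {0..<n} (\<lambda>_. S))"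
      unfolding X_def by (intro sets_PiM_I_finite) auto
    have space: "space (chain_law S K s) = space (PiM UNIV (\<lambda>_. S))"
      by (rule sets_eq_imp_space_eq[OF sets_chain_law[OF kernel s]])
    have "{\<omega> \<in> space (chain_law S K s). \<forall>j<n. \<omega> j \<in> B} = IT.PF.emb UNIV {0..<n} X"
      unfolding space X_def by (auto simp: prod_emb_def space_PiM PiE_iff restrict_def)
    then have "emeasure (chain_law S K s) {\<omega> \<in> space (chain_law S K s). \<forall>j<n. \<omega> j \<in> B} = emeasure (IT.CI {0..<n}) X"
      unfolding chain_law_def using IT.lim[OF _ X] by simp
    also have "\<dots> = emeasure (C n) X"
    proof -
      have "IT.PF.emb {0..<n} {0..<n} X = X"
        using BS by (intro prod_emb_id) (auto simp: X_def PiE_iff)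
      then show ?thesis using IT.emeasure_CI[OF order_refl X] by (simp add: C_def)
    qed
    also have "\<dots> = (\<integral>\<^sup>+x. indicator X x \<partial>C n)" using X sets_C by simp
    also have "\<dots> = (\<integral>\<^sup>+x. indicator {x. \<forall>j<m. x j \<in> B} x * ennreal (survival K B 1 (x m)) \<partial>C (Suc m))"
      unfolding Suc[symmetric]
    proof (rule nn_integral_cong)
      fix x assume x: "x \<in> space (C n)"
      then have "x m \<in> space S" by (auto simp: space_C space_PiM Suc)
      moreover have "survival K B 0 = (\<lambda>_. 1)" by (simp add: fun_eq_iff)
      ultimately have "survival K B 1 (x m) = indicator B (x m)"
        using kernel_op_const[of "x m" 1] by simp
      moreover have "x \<in> X \<longleftrightarrow> (\<forall>j<m. x j \<in> B) \<and> x m \<in> B"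
        using x by (auto simp: X_def Suc space_C space_PiM PiE_iff less_Suc_eq)
      ultimately show "indicator X x = indicator {x. \<forall>j<m. x j \<in> B} x * ennreal (survival K B 1 (x m))"
        by (auto simp: indicator_def)
    qed
    also have "\<dots> = ennreal ((T ^^ m) (survival K B 1) s)"
      by (rule path[OF unit_valued_survival[OF B]])
    also have "(T ^^ m) (survival K B 1) s = survival K B n s"
      using survival_T[of n] survival_T[of 1] by (simp add: Suc funpow_swap1 del: survival.simps)
    finally show ?thesis
      using unit_valuedD(2)[OF unit_valued_survival[OF B] s] by (simp add: measure_def)
  qed
qed

text \<open>
  The finite-horizon form of recurrence, in which the arguments about harmonic functions can be
  carried out without returning to the path space.
\<close>

lemma visited_imp_survival_tendsto_0:
  assumes s: "s \<in> space S" and A[measurable]: "A \<in> sets S"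
    and visits: "AE \<omega> in chain_law S K s. infinite {n. \<omega> n \<in> A}"
  shows "(\<lambda>n. survival K (space S - A) n s) \<longlonglongrightarrow> 0"
proof -
  interpret P: prob_space "chain_law S K s" by (rule prob_space_chain_law[OF kernel s])
  define E where "E n = {\<omega> \<in> space (chain_law S K s). \<forall>j<n. \<omega> j \<in> space S - A}" for n
  have comp[measurable]: "(\<lambda>\<omega>. \<omega> j) \<in> measurable (chain_law S K s) S" for j
    using measurable_component_singleton[of j UNIV "\<lambda>_. S"] measurable_cong_sets[OF sets_chain_law[OF kernel s] refl] by blast
  have E[measurable]: "E n \<in> sets (chain_law S K s)" for n unfolding E_def by measurable
  have "(\<lambda>n. measure (chain_law S K s) (E n)) \<longlonglongrightarrow> measure (chain_law S K s) (\<Inter>n. E n)"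
    by (intro P.finite_Lim_measure_decseq) (auto simp: E_def decseq_def)
  moreover have "measure (chain_law S K s) (\<Inter>n. E n) = 0"
  proof -
    have "AE \<omega> in chain_law S K s. \<omega> \<notin> (\<Inter>n. E n)"
      using visits
    proof eventually_elim
      case (elim \<omega>)
      then obtain j where "\<omega> j \<in> A" using not_finite_existsD by blast
      then have "\<omega> \<notin> E (Suc j)" by (auto simp: E_def)
      then show ?case by blast
    qed
    then show ?thesis by (subst P.prob_eq_0) auto
  qed
  moreover have "measure (chain_law S K s) (E n) = survival K (space S - A) n s" for n
    unfolding E_def by (rule chain_law_stays[OF s]) simp
  ultimately show ?thesis by simp
qed

end

section \<open>Stationary kernels\<close>

locale stationary_kernel = markov_kernel +
  fixes \<pi> :: "'a measure"
  assumes stationary: "stationary_distribution S K \<pi>"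
begin

lemma prob_space_pi: "prob_space \<pi>" and sets_pi: "sets \<pi> = sets S"
  using stationary by (auto simp: stationary_distribution_def)

lemma space_pi: "space \<pi> = space S"
  by (intro sets_eq_imp_space_eq sets_pi)

lemma bind_pi: "\<pi> \<bind> K = \<pi>"
proof (rule measure_eqI)
  have ne: "space \<pi> \<noteq> {}" using prob_space.not_empty[OF prob_space_pi] .
  show "sets (\<pi> \<bind> K) = sets \<pi>"
    using sets_bind_K[OF prob_space_pi sets_pi] sets_pi by simp
  fix A assume "A \<in> sets (\<pi> \<bind> K)"
  then have A: "A \<in> sets S" using sets_bind_K[OF prob_space_pi sets_pi] by simp
  show "emeasure (\<pi> \<bind> K) A = emeasure \<pi> A"
    using stationary A emeasure_bind[OF ne measurable_bind_K[OF sets_pi] A]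
    by (simp add: stationary_distribution_def)
qed

lemma integrable_pi: "unit_valued S g \<Longrightarrow> integrable \<pi> g"
  by (rule unit_valued_integrable[OF _ prob_space_pi sets_pi])

lemma integral_kernel_op: "unit_valued S g \<Longrightarrow> (\<integral>y. kernel_op K g y \<partial>\<pi>) = (\<integral>y. g y \<partial>\<pi>)"
  using integral_bind_K[OF _ prob_space_pi sets_pi] by (simp add: bind_pi)

lemma AE_pi_K: "Measurable.pred S P \<Longrightarrow> AE y in \<pi>. P y \<Longrightarrow> AE s in \<pi>. AE y in K s. P y"
  by (rule AE_bind_K[OF sets_pi]) (simp_all only: bind_pi)

text \<open>
  A set that is absorbing up to a null set of starting points is never left. Almost sure statements
  can be propagated along the chain since \<open>\<pi>\<close> is invariant.
\<close>

lemma survival_AE_eq_1: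
  assumes A[measurable]: "A \<in> sets S" and absorbing: "AE s in \<pi>. s \<in> A \<longrightarrow> (AE y in K s. y \<in> A)"
  shows "AE s in \<pi>. s \<in> A \<longrightarrow> survival K A n s = 1"
proof (induction n)
  case (Suc n)
  have [measurable]: "survival K A n \<in> borel_measurable S"
    by (intro unit_valuedD unit_valued_survival A)
  have "AE s in \<pi>. AE y in K s. y \<in> A \<longrightarrow> survival K A n y = 1"
    by (intro AE_pi_K Suc.IH) measurable
  with absorbing AE_space show ?case
  proof eventually_elim
    case (elim s)
    show ?case
    proof
      assume s: "s \<in> A"
      have "AE y in K s. survival K A n y = 1"
        using elim(1)[rule_format, OF s] elim(3) by eventually_elim simp
      then show "survival K A (Suc n) s = 1"
        using s elim(2) by (simp add: space_pi kernel_op_AE_eq_1 unit_valued_survival)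
    qed
  qed
qed simp

lemma integral_funpow: "unit_valued S g \<Longrightarrow> (\<integral>y. (kernel_op K ^^ n) g y \<partial>\<pi>) = (\<integral>y. g y \<partial>\<pi>)"
  by (induction n) (simp_all add: integral_kernel_op unit_valued_funpow)

end

context stationary_kernel
begin

definition stationary_survival :: "'a set \<Rightarrow> nat \<Rightarrow> real" where
  "stationary_survival B n = (\<integral>s. survival K B n s \<partial>\<pi>)"

lemma stationary_survival_0: "stationary_survival B 0 = 1"
  using prob_space.prob_space[OF prob_space_pi] by (simp add: stationary_survival_def)

lemma stationary_survival_1:
  assumes "B \<in> sets S"
  shows "stationary_survival B 1 = measure \<pi> B"
proof -
  have "stationary_survival B 1 = (\<integral>s. indicator B s \<partial>\<pi>)"
    unfolding stationary_survival_def
  proof (intro Bochner_Integration.integral_cong refl)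
    fix s assume "s \<in> space \<pi>"
    moreover have "survival K B 0 = (\<lambda>_. 1)" by (simp add: fun_eq_iff)
    ultimately show "survival K B 1 s = indicator B s"
      using kernel_op_const[of s 1] by (simp add: space_pi)
  qed
  then show ?thesis using assms by (simp add: sets_pi space_pi sets.Int_space_eq2)
qed

lemma stationary_survival_bounds:
  assumes "B \<in> sets S"
  shows "0 \<le> stationary_survival B n" "stationary_survival B n \<le> 1"
  unfolding stationary_survival_def
  by (rule unit_valued_integral[OF unit_valued_survival[OF assms] prob_space_pi sets_pi])+

lemma stationary_survival_antimono: "B \<in> sets S \<Longrightarrow> antimono (stationary_survival B)"
  unfolding stationary_survival_def
  by (intro antimonoI integral_mono integrable_pi unit_valued_survival) (auto simp: space_pi intro: antimonoD[OF survival_antimono])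

lemma stationary_survival_mono_set:
  "A \<in> sets S \<Longrightarrow> B \<in> sets S \<Longrightarrow> A \<subseteq> B \<Longrightarrow> stationary_survival A n \<le> stationary_survival B n"
  unfolding stationary_survival_def
  by (intro integral_mono integrable_pi unit_valued_survival survival_mono_set) (auto simp: space_pi)

text \<open>
  By stationarity, each further step kills at most the mass of the complement of \<open>B\<close>.
\<close>

lemma stationary_survival_jump:
  assumes B: "B \<in> sets S"
  shows "stationary_survival B a - stationary_survival B (a + l) \<le> real l * (1 - measure \<pi> B)"
proof (induction l)
  case (Suc l)
  note u = unit_valued_survival[OF B, of "a + l"]
  note op = unit_valued_kernel_op[OF u]
  have int: "integrable \<pi> (indicator B :: 'a \<Rightarrow> real)" by (rule integrable_pi[OF unit_valued_indicator[OF B]])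
  interpret prob_space \<pi> by (rule prob_space_pi)
  have "stationary_survival B (a + l) - (1 - measure \<pi> B)
      = (\<integral>s. kernel_op K (survival K B (a + l)) s - (1 - indicator B s) \<partial>\<pi>)"
    using integrable_pi[OF op] int B
    by (simp add: stationary_survival_def integral_kernel_op[OF u] sets_pi space_pi sets.Int_space_eq2 prob_space[unfolded space_pi])
  also have "\<dots> \<le> stationary_survival B (Suc (a + l))"
    unfolding stationary_survival_def
  proof (rule integral_mono)
    show "integrable \<pi> (\<lambda>s. kernel_op K (survival K B (a + l)) s - (1 - indicator B s))"
      using integrable_pi[OF op] int by simp
    show "integrable \<pi> (survival K B (Suc (a + l)))" by (rule integrable_pi[OF unit_valued_survival[OF B]])
    show "kernel_op K (survival K B (a + l)) s - (1 - indicator B s) \<le> survival K B (Suc (a + l)) s"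
      if "s \<in> space \<pi>" for s
      using unit_valuedD(3)[OF op, of s] that by (simp add: space_pi indicator_def)
  qed
  finally show ?case using Suc by (simp add: algebra_simps)
qed simp

text \<open>
  Applied to level sets of \<open>f\<close>, this union bound transfers continuity from the marginal distribution
  function to the distribution function of the maximum.
\<close>

lemma stationary_survival_diff_le:
  assumes A: "A \<in> sets S" and B: "B \<in> sets S" and AB: "A \<subseteq> B"
  shows "stationary_survival B n - stationary_survival A n \<le> real n * (measure \<pi> B - measure \<pi> A)"
proof (induction n)
  case (Suc n)
  note uA = unit_valued_survival[OF A] and uB = unit_valued_survival[OF B]
  note pA = unit_valued_kernel_op[OF uA[of n]] and pB = unit_valued_kernel_op[OF uB[of n]]
  note intA = integrable_pi[OF unit_valued_indicator[OF A]] and intB = integrable_pi[OF unit_valued_indicator[OF B]]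
  have "stationary_survival B (Suc n) - stationary_survival A (Suc n)
      = (\<integral>s. survival K B (Suc n) s - survival K A (Suc n) s \<partial>\<pi>)"
    unfolding stationary_survival_def
    by (rule Bochner_Integration.integral_diff[symmetric, OF integrable_pi[OF uB] integrable_pi[OF uA]])
  also have "\<dots> \<le> (\<integral>s. (indicator B s - indicator A s) + (kernel_op K (survival K B n) s - kernel_op K (survival K A n) s) \<partial>\<pi>)"
  proof (intro integral_mono)
    show "integrable \<pi> (\<lambda>s. survival K B (Suc n) s - survival K A (Suc n) s)"
      by (rule Bochner_Integration.integrable_diff[OF integrable_pi[OF uB] integrable_pi[OF uA]])
    show "integrable \<pi> (\<lambda>s. (indicator B s - indicator A s) + (kernel_op K (survival K B n) s - kernel_op K (survival K A n) s))"
      using intA intB integrable_pi[OF pA] integrable_pi[OF pB] by auto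
    fix s assume "s \<in> space \<pi>"
    then have s: "s \<in> space S" by (simp add: space_pi)
    have "kernel_op K (survival K A n) s \<le> kernel_op K (survival K B n) s"
      by (rule kernel_op_mono[OF uA uB s survival_mono_set[OF A B AB]])
    with unit_valuedD(2,3)[OF pA s] unit_valuedD(2,3)[OF pB s] AB
    show "survival K B (Suc n) s - survival K A (Suc n) s
        \<le> (indicator B s - indicator A s) + (kernel_op K (survival K B n) s - kernel_op K (survival K A n) s)"
      by (auto simp: indicator_def)
  qed
  also have "\<dots> = measure \<pi> B - measure \<pi> A + (stationary_survival B n - stationary_survival A n)"
    using intA intB integrable_pi[OF pA] integrable_pi[OF pB] A B
    by (simp add: stationary_survival_def integral_kernel_op[OF uA] integral_kernel_op[OF uB] sets_pi space_pi sets.Int_space_eq2)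
  finally show ?case using Suc by (simp add: algebra_simps)
qed (simp add: stationary_survival_0)

lemma stationary_survival_add:
  assumes B: "B \<in> sets S"
  shows "\<bar>stationary_survival B (m + n) - stationary_survival B m * stationary_survival B n\<bar>
    \<le> (\<integral>s. \<bar>survival K B n s - stationary_survival B n\<bar> \<partial>\<pi>)"
proof -
  let ?c = "stationary_survival B n"
  note u = unit_valued_survival[OF B]
  note c = stationary_survival_bounds[OF B, of n]
  note ud = unit_valued_abs_diff[OF u unit_valued_const[OF c], of n]
  have "stationary_survival B (m + n) - stationary_survival B m * ?c
      = (\<integral>s. survival K B (m + n) s - survival K B m s * ?c \<partial>\<pi>)"
    using integrable_pi[OF u[of "m + n"]] integrable_pi[OF u[of m]]
    by (simp add: stationary_survival_def)
  also have "\<bar>\<dots>\<bar> \<le> (\<integral>s. \<bar>survival K B (m + n) s - survival K B m s * ?c\<bar> \<partial>\<pi>)"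
    by (rule integral_abs_bound)
  also have "\<dots> \<le> (\<integral>s. (kernel_op K ^^ m) (\<lambda>y. \<bar>survival K B n y - ?c\<bar>) s \<partial>\<pi>)"
    by (intro integral_mono integrable_pi[OF unit_valued_funpow[OF ud]]
          integrable_pi[OF unit_valued_abs_diff[OF u unit_valued_mult[OF u unit_valued_const[OF c]]]]
          survival_add_abs_diff B c) (simp add: space_pi)
  also have "\<dots> = (\<integral>s. \<bar>survival K B n s - ?c\<bar> \<partial>\<pi>)" by (rule integral_funpow[OF ud])
  finally show ?thesis .
qed

end

section \<open>Almost everywhere convergent averages\<close>

text \<open>
  A geometric mixture charges every \<open>\<nu> j\<close>, so its null sets are the common null sets.
\<close>

lemma exists_mixture:
  fixes \<nu> :: "nat \<Rightarrow> 'a measure"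
  assumes \<nu>: "\<And>j. prob_space (\<nu> j)" "\<And>j. sets (\<nu> j) = sets S"
  obtains m where "prob_space m" "sets m = sets S"
    "\<And>P. Measurable.pred S P \<Longrightarrow> (AE y in m. P y) \<longleftrightarrow> (\<forall>j. AE y in \<nu> j. P y)"
proof -
  define p where "p = geometric_pmf (1/2)"
  have meas: "\<nu> \<in> measurable (measure_pmf p) (subprob_algebra S)"
    using \<nu> by (auto simp: measurable_pmf_measure1 space_subprob_algebra prob_space_imp_subprob_space)
  show thesis
  proof
    show "prob_space (measure_pmf p \<bind> \<nu>)"
      using \<nu> by (intro prob_space.prob_space_bind[OF prob_space_measure_pmf _ meas] AE_I2) simp
    show "sets (measure_pmf p \<bind> \<nu>) = sets S"
      using \<nu> by (intro sets_bind) auto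
    show "(AE y in measure_pmf p \<bind> \<nu>. P y) \<longleftrightarrow> (\<forall>j. AE y in \<nu> j. P y)" if "Measurable.pred S P" for P
      using that by (simp add: AE_bind[OF meas] AE_measure_pmf_iff p_def set_pmf_geometric)
  qed
qed

text \<open>
  Dyadic convex combinations of \<open>g n, g (n + 1), \<dots>\<close>. Midpoints are all that the parallelogram law
  asks for, and they allow properties to be propagated by rule induction without handling weights.
\<close>

inductive_set midpoint_hull :: "(nat \<Rightarrow> 'a \<Rightarrow> real) \<Rightarrow> nat \<Rightarrow> ('a \<Rightarrow> real) set"
  for g :: "nat \<Rightarrow> 'a \<Rightarrow> real" and n :: nat where
  base: "n \<le> i \<Longrightarrow> g i \<in> midpoint_hull g n"
| midpoint: "a \<in> midpoint_hull g n \<Longrightarrow> b \<in> midpoint_hull g n \<Longrightarrow> (\<lambda>x. (a x + b x) / 2) \<in> midpoint_hull g n"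

lemma midpoint_hull_antimono:
  assumes "m \<le> n" "a \<in> midpoint_hull g n"
  shows "a \<in> midpoint_hull g m"
  using assms(2,1) by induction (auto intro: midpoint_hull.intros)

lemma unit_valued_midpoint_hull:
  assumes "\<And>i. unit_valued S (g i)" "a \<in> midpoint_hull g n"
  shows "unit_valued S a"
  using assms(2) by induction (auto intro: assms(1) unit_valued_midpoint)

text \<open>
  A bounded sequence need not have an almost everywhere convergent subsequence, but averages of its
  tails do: elements of the hull with nearly minimal \<open>L\<^sup>2\<close> norm form a Cauchy sequence, because the
  midpoint of two of them cannot have a much smaller norm.
\<close>

lemma midpoint_hull_AE_convergent:
  assumes M: "prob_space M" and g: "\<And>i. unit_valued M (g i)"
  obtains k where "\<And>n. k n \<in> midpoint_hull g n" "AE x in M. convergent (\<lambda>n. k n x)"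
proof -
  interpret prob_space M by fact
  note unit = unit_valued_midpoint_hull[OF g]
  define E where "E a = (\<integral>x. a x * a x \<partial>M)" for a :: "'a \<Rightarrow> real"
  have E_nn: "0 \<le> E a" for a by (auto simp: E_def intro!: integral_nonneg)
  have E_le: "E a \<le> 1" if "unit_valued M a" for a
    unfolding E_def by (rule unit_valued_integral(2)[OF unit_valued_mult[OF that that] M refl])
  define J where "J n = Inf (E ` midpoint_hull g n)" for n
  have bdd: "bdd_below (E ` midpoint_hull g n)" for n using E_nn by (auto intro!: bdd_belowI)
  have ne: "midpoint_hull g n \<noteq> {}" for n using midpoint_hull.base[of n n g] by auto
  have J_le: "J n \<le> E a" if "a \<in> midpoint_hull g n" for a n
    unfolding J_def using that bdd by (intro cInf_lower) auto
  have J_mono: "incseq J"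
    unfolding J_def using bdd ne by (intro monoI cInf_superset_mono image_mono subsetI) (auto intro: midpoint_hull_antimono)
  have J_le1: "J n \<le> 1" for n
    using J_le[OF midpoint_hull.base[OF order_refl]] E_le[OF g] order_trans by blast
  obtain L where L: "J \<longlonglongrightarrow> L" and J_L: "\<And>n. J n \<le> L"
    using incseq_convergent[OF J_mono] J_le1 by (auto simp: incseq_def)
  have "\<exists>a\<in>midpoint_hull g n. E a < J n + 1 / real (Suc n)" for n
    using cInf_lessD[of "E ` midpoint_hull g n" "J n + 1 / real (Suc n)"] ne by (auto simp: J_def)
  then obtain h where h: "\<And>n. h n \<in> midpoint_hull g n" and Eh: "\<And>n. E (h n) < J n + 1 / real (Suc n)"
    by metis
  have uh: "unit_valued M (h n)" for n by (rule unit[OF h])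
  have int: "integrable M (\<lambda>x. h i x * h j x)" for i j
    by (rule unit_valued_integrable[OF unit_valued_mult[OF uh uh] M refl])
  have parallelogram: "(\<integral>x. (h i x - h j x)\<^sup>2 \<partial>M) \<le> 4 * (L - J n) + 4 / real (Suc n)" if "n \<le> i" "n \<le> j" for i j n
  proof -
    let ?m = "\<lambda>x. (h i x + h j x) / 2"
    have m: "?m \<in> midpoint_hull g n"
      using that by (intro midpoint_hull.midpoint midpoint_hull_antimono[OF _ h])
    have "(\<integral>x. (h i x - h j x)\<^sup>2 \<partial>M) = (\<integral>x. 2 * (h i x * h i x) + 2 * (h j x * h j x) - 4 * (?m x * ?m x) \<partial>M)"
      by (intro Bochner_Integration.integral_cong) (auto simp: power2_eq_square field_simps)
    also have "\<dots> = 2 * E (h i) + 2 * E (h j) - 4 * E ?m"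
      unfolding E_def using int[of i i] int[of j j]
      by (subst Bochner_Integration.integral_diff[OF _ integrable_mult_right[OF
            unit_valued_integrable[OF unit_valued_mult[OF unit[OF m] unit[OF m]] M refl]]]) simp_all
    also have "\<dots> \<le> 4 * (L - J n) + 4 / real (Suc n)"
    proof -
      have "1 / real (Suc i) \<le> 1 / real (Suc n)" "1 / real (Suc j) \<le> 1 / real (Suc n)"
        using that by (simp_all add: frac_le)
      then show ?thesis using J_le[OF m] Eh[of i] Eh[of j] J_L[of i] J_L[of j] by simp
    qed
    finally show ?thesis .
  qed
  have "(\<lambda>n. 4 * (L - J n) + 4 / real (Suc n)) \<longlonglongrightarrow> 4 * (L - L) + 0"
    by (intro tendsto_intros L LIMSEQ_Suc[OF lim_const_over_n])
  then have small: "\<exists>n. 4 * (L - J n) + 4 / real (Suc n) < d" if "0 < d" for d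
    using order_tendstoD(2)[of _ 0 sequentially d] that
    by (auto dest: eventually_happens'[OF sequentially_bot])
  have cauchy: "\<exists>N. \<forall>i\<ge>N. \<forall>j\<ge>N. (\<integral>x. norm (h i x - h j x) \<partial>M) < e" if e: "0 < e" for e
  proof -
    obtain N where N: "4 * (L - J N) + 4 / real (Suc N) < e\<^sup>2" using small[of "e\<^sup>2"] e by auto
    have "(\<integral>x. norm (h i x - h j x) \<partial>M) < e" if "N \<le> i" "N \<le> j" for i j
    proof -
      let ?d = "\<lambda>x. h i x - h j x"
      have [simp]: "integrable M (\<lambda>x. (?d x)\<^sup>2)"
        unfolding power2_eq_square
        using unit_valued_integrable[OF unit_valued_mult[OF unit_valued_abs_diff[OF uh uh] unit_valued_abs_diff[OF uh uh]] M refl, of i j i j]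
        by simp
      have [simp]: "integrable M ?d" using unit_valued_integrable[OF uh M refl] by simp
      have "(\<integral>x. norm (?d x) \<partial>M) \<le> (\<integral>x. (e + (?d x)\<^sup>2 / e) / 2 \<partial>M)"
      proof (intro integral_mono)
        \<comment> \<open>The inequality of arithmetic and geometric means replaces the Cauchy-Schwarz inequality.\<close>
        fix x
        have "0 \<le> (\<bar>?d x\<bar> - e)\<^sup>2" by simp
        then have "2 * e * \<bar>?d x\<bar> \<le> e * e + (?d x)\<^sup>2" by (simp add: power2_diff power2_eq_square algebra_simps)
        then show "norm (?d x) \<le> (e + (?d x)\<^sup>2 / e) / 2" using e by (simp add: field_simps)
      qed auto
      also have "\<dots> = (e + (\<integral>x. (?d x)\<^sup>2 \<partial>M) / e) / 2"
        by (simp add: prob_space)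
      also have "\<dots> < (e + e\<^sup>2 / e) / 2"
        using parallelogram[OF that] N e by (intro divide_strict_right_mono add_strict_left_mono) auto
      also have "\<dots> = e" using e by (simp add: power2_eq_square)
      finally show ?thesis .
    qed
    then show ?thesis by auto
  qed
  obtain r where r: "strict_mono r" "AE x in M. Cauchy (\<lambda>i. h (r i) x)"
    using cauchy_L1_AE_cauchy_subseq[OF unit_valued_integrable[OF uh M refl] cauchy] by blast
  show thesis
  proof
    show "h (r n) \<in> midpoint_hull g n" for n
      by (rule midpoint_hull_antimono[OF seq_suble[OF r(1)] h])
    show "AE x in M. convergent (\<lambda>n. h (r n) x)"
      using r(2) by eventually_elim (rule Cauchy_convergent)
  qed
qed

section \<open>Harmonic functions of a Harris kernel\<close>

text \<open>
  The assumption \<open>hits\<close> says that sets charged by \<open>\<phi>\<close> are reached almost surely from every starting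
  point; phrasing it through \<open>survival\<close> keeps path measures out of the locale.
\<close>

locale harris_kernel = stationary_kernel +
  fixes \<phi> :: "'a measure"
  assumes sets_phi: "sets \<phi> = sets S" and phi_nontrivial: "emeasure \<phi> (space S) > 0"
    and hits: "\<And>A s. A \<in> sets S \<Longrightarrow> emeasure \<phi> A > 0 \<Longrightarrow> s \<in> space S \<Longrightarrow>
      (\<lambda>n. survival K (space S - A) n s) \<longlonglongrightarrow> 0"
begin

text \<open>
  A chain that starts in an absorbing set stays there, which contradicts the certain visit to the
  charged complement.
\<close>

lemma absorbing_null:
  assumes A: "A \<in> sets S" and absorbing: "AE s in \<pi>. s \<in> A \<longrightarrow> (AE y in K s. y \<in> A)"
    and charged: "emeasure \<phi> (space S - A) > 0"
  shows "AE s in \<pi>. s \<notin> A"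
proof -
  have "AE s in \<pi>. \<forall>n. s \<in> A \<longrightarrow> survival K A n s = 1"
    unfolding AE_all_countable by (intro allI survival_AE_eq_1 A absorbing)
  with AE_space show ?thesis
  proof eventually_elim
    case (elim s)
    show ?case
    proof
      assume "s \<in> A"
      moreover have "space S - (space S - A) = A" using sets.sets_into_space[OF A] by blast
      moreover have "(\<lambda>n. survival K (space S - (space S - A)) n s) \<longlonglongrightarrow> 0"
        using A charged elim by (intro hits) (auto simp: space_pi)
      ultimately have "(\<lambda>n. 1::real) \<longlonglongrightarrow> 0" using elim by simp
      then show False by (simp add: LIMSEQ_const_iff)
    qed
  qed
qed

text \<open>
  The complement of a \<open>\<pi>\<close>-null set is absorbing up to a null set by stationarity. If \<open>\<phi>\<close> charged the
  null set, the complement would be null as well.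
\<close>

lemma phi_absolutely_continuous:
  assumes N: "N \<in> null_sets \<pi>"
  shows "emeasure \<phi> N = 0"
proof (rule ccontr)
  assume "emeasure \<phi> N \<noteq> 0"
  have N_sets[measurable]: "N \<in> sets S" using N sets_pi by auto
  let ?A = "space S - N"
  have "space S - ?A = N" using sets.sets_into_space[OF N_sets] by blast
  then have pos: "emeasure \<phi> (space S - ?A) > 0"
    using \<open>emeasure \<phi> N \<noteq> 0\<close> by (simp add: zero_less_iff_neq_zero)
  have ae: "AE y in \<pi>. y \<in> ?A" using AE_not_in[OF N] AE_space by eventually_elim (simp add: space_pi)
  have "AE s in \<pi>. AE y in K s. y \<in> ?A" by (rule AE_pi_K[OF _ ae]) measurable
  then have "AE s in \<pi>. s \<in> ?A \<longrightarrow> (AE y in K s. y \<in> ?A)" by eventually_elim simp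
  from absorbing_null[OF _ this pos] ae have "AE s in \<pi>. False" by (auto elim: eventually_elim2)
  then show False using prob_space.AE_False[OF prob_space_pi] by simp
qed

text \<open>
  At least one of the two absorbing sets is charged by the nontrivial measure \<open>\<phi>\<close>, so the other one
  is null.
\<close>

lemma absorbing_zero_one:
  assumes A: "A \<in> sets S" and A_absorbing: "AE s in \<pi>. s \<in> A \<longrightarrow> (AE y in K s. y \<in> A)"
    and compl_absorbing: "AE s in \<pi>. s \<notin> A \<longrightarrow> (AE y in K s. y \<notin> A)"
  shows "(AE s in \<pi>. s \<in> A) \<or> (AE s in \<pi>. s \<notin> A)"
proof (cases "emeasure \<phi> (space S - A) > 0")
  case True
  from absorbing_null[OF A A_absorbing this] show ?thesis ..
next
  case False
  have "emeasure \<phi> (space S) = emeasure \<phi> A + emeasure \<phi> (space S - A)"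
    using A sets.sets_into_space[OF A] by (subst plus_emeasure) (auto simp: sets_phi Un_absorb1)
  with False phi_nontrivial have "emeasure \<phi> A > 0" by simp
  moreover have "space S - (space S - A) = A" using sets.sets_into_space[OF A] by blast
  moreover have "AE s in \<pi>. s \<in> space S - A \<longrightarrow> (AE y in K s. y \<in> space S - A)"
    using compl_absorbing AE_space
  proof eventually_elim
    case (elim s)
    have "AE y in K s. y \<in> space (K s)" by (rule AE_space)
    with elim show ?case by (auto simp: space_pi space_K elim: eventually_elim2)
  qed
  ultimately have "AE s in \<pi>. s \<notin> space S - A"
    using A by (intro absorbing_null) auto
  then have "AE s in \<pi>. s \<in> A" using AE_space by eventually_elim (simp add: space_pi)
  then show ?thesis ..
qed

text \<open>
  For harmonic \<open>h\<close> the conditional variance of \<open>h(Y\<^sub>1)\<close> given \<open>Y\<^sub>0\<close> is \<open>K h\<^sup>2 - h\<^sup>2\<close>, whose mean under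
  the invariant measure vanishes. So \<open>h(Y\<^sub>1) = h(Y\<^sub>0)\<close> almost surely, each set \<open>{h > c}\<close> is absorbing
  together with its complement, and the zero-one law applies to the level \<open>c = \<pi>(h)\<close>.
\<close>

lemma harmonic_AE_const:
  assumes h: "unit_valued S h" and harmonic: "AE s in \<pi>. kernel_op K h s = h s"
  shows "AE s in \<pi>. h s = (\<integral>y. h y \<partial>\<pi>)"
proof -
  have [measurable]: "h \<in> borel_measurable S" by (rule unit_valuedD[OF h])
  note hh = unit_valued_mult[OF h h] and Ph = unit_valued_kernel_op[OF h]
  note Phh = unit_valued_kernel_op[OF hh]
  have variance: "(\<integral>y. (h y - h s)\<^sup>2 \<partial>K s) = kernel_op K (\<lambda>y. h y * h y) s - 2 * h s * kernel_op K h s + h s * h s"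
    if s: "s \<in> space S" for s
  proof -
    interpret prob_space "K s" using s by (rule prob_space_K)
    have "(\<integral>y. (h y - h s)\<^sup>2 \<partial>K s) = (\<integral>y. h y * h y - 2 * h s * h y + h s * h s \<partial>K s)"
      by (intro Bochner_Integration.integral_cong) (auto simp: power2_eq_square algebra_simps)
    then show ?thesis
      using integrable_K[OF h s] integrable_K[OF hh s] by (simp add: kernel_op_def prob_space)
  qed
  have "AE s in \<pi>. 0 = kernel_op K (\<lambda>y. h y * h y) s - h s * h s"
  proof -
    have int: "integrable \<pi> (\<lambda>s. kernel_op K (\<lambda>y. h y * h y) s - h s * h s)"
      by (intro Bochner_Integration.integrable_diff integrable_pi Phh hh)
    have nonneg: "AE s in \<pi>. 0 \<le> kernel_op K (\<lambda>y. h y * h y) s - h s * h s"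
      using harmonic AE_space
    proof eventually_elim
      case (elim s)
      then have "s \<in> space S" by (simp add: space_pi)
      from variance[OF this] elim(1)
      have "kernel_op K (\<lambda>y. h y * h y) s - h s * h s = (\<integral>y. (h y - h s)\<^sup>2 \<partial>K s)" by simp
      then show ?case by simp
    qed
    have "(\<integral>s. kernel_op K (\<lambda>y. h y * h y) s - h s * h s \<partial>\<pi>) = 0"
      by (simp add: Bochner_Integration.integral_diff integrable_pi[OF Phh] integrable_pi[OF hh] integral_kernel_op[OF hh])
    with integral_nonneg_eq_0_iff_AE[OF int nonneg] show ?thesis
      by (auto elim: eventually_mono)
  qed
  with harmonic AE_space have const_step: "AE s in \<pi>. AE y in K s. h y = h s"
  proof eventually_elim
    case (elim s)
    then have s: "s \<in> space S" by (simp add: space_pi)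
    then have "(\<integral>y. (h y - h s)\<^sup>2 \<partial>K s) = 0" using variance[OF s] elim by simp
    moreover have "integrable (K s) (\<lambda>y. (h y - h s)\<^sup>2)"
      using unit_valuedD(2,3)[OF h s]
        integrable_K[OF unit_valued_mult[OF unit_valued_abs_diff[OF h unit_valued_const] unit_valued_abs_diff[OF h unit_valued_const]] s, of "h s" "h s"]
      by (simp add: power2_eq_square)
    ultimately have "AE y in K s. (h y - h s)\<^sup>2 = 0"
      by (subst (asm) integral_nonneg_eq_0_iff_AE) auto
    then show ?case by eventually_elim simp
  qed
  define c where "c = (\<integral>y. h y \<partial>\<pi>)"
  interpret prob_space \<pi> by (rule prob_space_pi)
  define A where "A = {s \<in> space S. h s > c}"
  have A: "A \<in> sets S" unfolding A_def by measurable
  have side_kept: "AE s in \<pi>. AE y in K s. y \<in> A \<longleftrightarrow> s \<in> A"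
    using const_step AE_space
  proof eventually_elim
    case (elim s)
    have "AE y in K s. y \<in> space (K s)" by (rule AE_space)
    with elim(1) show ?case by eventually_elim (use elim(2) in \<open>simp add: A_def space_pi space_K\<close>)
  qed
  have "AE s in \<pi>. s \<in> A \<longrightarrow> (AE y in K s. y \<in> A)" "AE s in \<pi>. s \<notin> A \<longrightarrow> (AE y in K s. y \<notin> A)"
    using side_kept by (auto elim!: eventually_mono)
  from absorbing_zero_one[OF A this] have "(AE s in \<pi>. 0 \<le> h s - c) \<or> (AE s in \<pi>. 0 \<le> c - h s)"
  proof
    assume "AE s in \<pi>. s \<in> A"
    then have "AE s in \<pi>. 0 \<le> h s - c" by eventually_elim (simp add: A_def)
    then show ?thesis ..
  next
    assume "AE s in \<pi>. s \<notin> A"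
    then have "AE s in \<pi>. 0 \<le> c - h s" using AE_space by eventually_elim (auto simp: A_def space_pi)
    then show ?thesis ..
  qed
  moreover have int: "integrable \<pi> (\<lambda>s. h s - c)" "integrable \<pi> (\<lambda>s. c - h s)"
    using integrable_pi[OF h] by auto
  moreover have "(\<integral>s. h s - c \<partial>\<pi>) = 0" "(\<integral>s. c - h s \<partial>\<pi>) = 0"
    using integrable_pi[OF h] by (simp_all add: c_def prob_space)
  ultimately have "(AE s in \<pi>. h s - c = 0) \<or> (AE s in \<pi>. c - h s = 0)"
    using integral_nonneg_eq_0_iff_AE by metis
  then show ?thesis by (auto simp: c_def elim: eventually_mono)
qed

text \<open>
  Let \<open>H\<close> be the set of points from which \<open>N\<close> can be reached. It is null by stationarity, its
  complement is absorbing and charged by \<open>\<phi>\<close>. From every \<open>s\<close> the chain therefore leaves \<open>H\<close>, never to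
  return. Consequently \<open>Y\<^sub>n \<in> H\<close> can happen only if the chain has stayed in \<open>H\<close> all the time.
\<close>

lemma null_set_avoided:
  assumes N: "N \<in> null_sets \<pi>" and s: "s \<in> space S"
  shows "(\<lambda>n. measure (marginal S K s n) N) \<longlonglongrightarrow> 0"
proof -
  have N_sets[measurable]: "N \<in> sets S" using N sets_pi by auto
  define q where "q n = (kernel_op K ^^ n) (indicator N :: 'a \<Rightarrow> real)" for n
  have q: "unit_valued S (q n)" for n
    unfolding q_def by (intro unit_valued_funpow unit_valued_indicator N_sets)
  have [measurable]: "q n \<in> borel_measurable S" for n by (rule unit_valuedD[OF q])
  have q_Suc: "q (Suc n) y = kernel_op K (q n) y" for n y by (simp add: q_def)
  define H where "H = {y \<in> space S. \<exists>n. q n y \<noteq> 0}"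
  have H[measurable]: "H \<in> sets S" unfolding H_def by measurable
  have "AE y in \<pi>. q n y = 0" for n
  proof -
    have "(\<integral>y. q n y \<partial>\<pi>) = (\<integral>y. indicator N y \<partial>\<pi>)"
      unfolding q_def by (intro integral_funpow unit_valued_indicator N_sets)
    also have "\<dots> = 0" using N by (simp add: measure_def null_setsD1)
    finally show ?thesis
      by (subst (asm) integral_nonneg_eq_0_iff_AE) (auto intro!: AE_I2 integrable_pi[OF q] unit_valuedD(2)[OF q] simp: space_pi)
  qed
  then have "AE y in \<pi>. \<forall>n. q n y = 0" by (simp add: AE_all_countable)
  then have "AE y in \<pi>. y \<notin> H" by eventually_elim (simp add: H_def)
  then have "H \<in> null_sets \<pi>" using H sets_pi by (subst AE_iff_null_sets) auto
  then have "emeasure \<phi> H = 0" by (rule phi_absolutely_continuous)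
  moreover have "emeasure \<phi> (space S) = emeasure \<phi> H + emeasure \<phi> (space S - H)"
    using sets.sets_into_space[OF H] H by (subst plus_emeasure) (auto simp: sets_phi Un_absorb1)
  ultimately have "emeasure \<phi> (space S - H) > 0" using phi_nontrivial by simp
  from hits[OF _ this s] have "(\<lambda>n. survival K (space S - (space S - H)) n s) \<longlonglongrightarrow> 0" by auto
  moreover have "space S - (space S - H) = H" using sets.sets_into_space[OF H] by blast
  ultimately have "(\<lambda>n. survival K H n s) \<longlonglongrightarrow> 0" by simp
  then have surv: "(\<lambda>n. survival K H (Suc n) s) \<longlonglongrightarrow> 0" by (rule LIMSEQ_Suc)
  have "q n y \<le> survival K H (Suc n) y" if "y \<in> space S" for n y
    using that
  proof (induction n arbitrary: y)
    case 0
    have "N \<subseteq> H" using sets.sets_into_space[OF N_sets] by (auto simp: H_def q_def intro!: exI[of _ 0])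
    moreover have "survival K H 0 = (\<lambda>_. 1)" by (simp add: fun_eq_iff)
    ultimately show ?case using kernel_op_const[OF 0, of 1] by (auto simp: q_def indicator_def)
  next
    case (Suc n)
    note sH = unit_valued_survival[OF H]
    show ?case
    proof (cases "y \<in> H")
      case True
      have "kernel_op K (q n) y \<le> kernel_op K (survival K H (Suc n)) y"
        using Suc by (intro kernel_op_mono q sH) auto
      then show ?thesis unfolding q_Suc survival.simps(2)[of K H "Suc n"] using True by simp
    next
      case False
      then have "q (Suc n) y = 0" using Suc.prems by (simp add: H_def)
      then show ?thesis using unit_valuedD(2)[OF sH Suc.prems, of "Suc (Suc n)"] by simp
    qed
  qed
  then have "q n s \<le> survival K H (Suc n) s" for n using s by blast
  moreover have "0 \<le> q n s" for n by (rule unit_valuedD(2)[OF q s])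
  ultimately have "(\<lambda>n. q n s) \<longlonglongrightarrow> 0"
    using surv by (intro tendsto_sandwich[OF _ _ tendsto_const surv]) auto
  moreover have "measure (marginal S K s n) N = q n s" for n
    unfolding q_def using marginal_eq_funpow[OF s unit_valued_indicator[OF N_sets], of n]
    by (simp add: sets_marginal[OF s] space_marginal[OF s] sets.Int_space_eq2[OF N_sets])
  ultimately show ?thesis by simp
qed

text \<open>
  The one-sided half of the compactness argument described at the beginning. The harmonic limit has
  to be controlled at the given point \<open>s\<close>, which may be \<open>\<pi>\<close>-null; therefore the dominating measure
  also charges the laws of the chain started at \<open>s\<close>.
\<close>

lemma asymptotically_harmonic_upper:
  assumes g: "\<And>n. unit_valued S (g n)"
    and harmonic: "\<And>y. y \<in> space S \<Longrightarrow> (\<lambda>n. kernel_op K (g n) y - g n y) \<longlonglongrightarrow> 0"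
    and s: "s \<in> space S" and e: "0 < e"
  shows "\<forall>\<^sub>F n in sequentially. g n s - (\<integral>y. g n y \<partial>\<pi>) < e"
proof (rule ccontr)
  assume "\<not> ?thesis"
  from not_eventually_sequentiallyD[OF this]
  obtain r :: "nat \<Rightarrow> nat" where r: "strict_mono r" and "\<forall>n. \<not> g (r n) s - (\<integral>y. g (r n) y \<partial>\<pi>) < e" by blast
  then have gap: "e \<le> g (r n) s - (\<integral>y. g (r n) y \<partial>\<pi>)" for n by (simp add: not_less)
  define \<nu> where "\<nu> j = (case j of 0 \<Rightarrow> \<pi> | Suc j \<Rightarrow> marginal S K s j)" for j
  have \<nu>_0: "\<nu> 0 = \<pi>" and \<nu>_Suc: "\<nu> (Suc j) = marginal S K s j" for j by (simp_all add: \<nu>_def)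
  have \<nu>: "prob_space (\<nu> j)" "sets (\<nu> j) = sets S" for j
    by (simp_all add: \<nu>_def prob_space_pi sets_pi prob_space_marginal[OF s] sets_marginal[OF s] split: nat.split)
  obtain m where m: "prob_space m" "sets m = sets S"
    and AE_m: "\<And>P. Measurable.pred S P \<Longrightarrow> (AE y in m. P y) \<longleftrightarrow> (\<forall>j. AE y in \<nu> j. P y)"
    using exists_mixture[of \<nu> S] \<nu> by blast
  have "unit_valued m (g (r i))" for i
    using g[of "r i"] m(2) sets_eq_imp_space_eq[OF m(2)] measurable_cong_sets[OF m(2) refl] by (auto simp: unit_valued_def)
  from midpoint_hull_AE_convergent[OF m(1), of "\<lambda>i. g (r i)", OF this]
  obtain k where k: "\<And>n. k n \<in> midpoint_hull (\<lambda>i. g (r i)) n" and conv: "AE y in m. convergent (\<lambda>n. k n y)" by blast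
  have k_unit: "unit_valued S (k n)" for n by (rule unit_valued_midpoint_hull[OF g k])
  have [measurable]: "k n \<in> borel_measurable S" for n by (rule unit_valuedD[OF k_unit])
  have hull_gap: "e \<le> a s - (\<integral>y. a y \<partial>\<pi>)" if "a \<in> midpoint_hull (\<lambda>i. g (r i)) n" for a n
    using that
  proof induction
    case (midpoint a b)
    have "integrable \<pi> a" "integrable \<pi> b"
      using midpoint.hyps by (auto intro!: integrable_pi unit_valued_midpoint_hull[OF g])
    then show ?case using midpoint.IH by (simp add: field_simps)
  qed (rule gap)
  have hull_harmonic: "\<bar>kernel_op K a y - a y\<bar> \<le> d"
    if a: "a \<in> midpoint_hull (\<lambda>i. g (r i)) n" and y: "y \<in> space S"
      and d: "\<And>i. n \<le> i \<Longrightarrow> \<bar>kernel_op K (g (r i)) y - g (r i) y\<bar> \<le> d" for a n y d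
    using a
  proof induction
    case (midpoint a b)
    have "unit_valued S a" "unit_valued S b"
      using midpoint.hyps by (auto intro!: unit_valued_midpoint_hull[OF g])
    then show ?case
      using midpoint.IH y by (simp add: kernel_op_midpoint) (simp add: abs_le_iff field_simps)
  qed (rule d)
  have k_harmonic: "(\<lambda>n. kernel_op K (k n) y - k n y) \<longlonglongrightarrow> 0" if y: "y \<in> space S" for y
  proof (rule tendstoI)
    fix d :: real assume "0 < d"
    from LIMSEQ_subseq_LIMSEQ[OF harmonic[OF y] r]
    have "(\<lambda>i. kernel_op K (g (r i)) y - g (r i) y) \<longlonglongrightarrow> 0" by (simp add: o_def)
    from tendstoD[OF this, of "d/2"]
    have "\<forall>\<^sub>F i in sequentially. \<bar>kernel_op K (g (r i)) y - g (r i) y\<bar> < d/2"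
      using \<open>0 < d\<close> by (simp add: dist_real_def)
    then obtain M where M: "\<And>i. M \<le> i \<Longrightarrow> \<bar>kernel_op K (g (r i)) y - g (r i) y\<bar> < d/2"
      by (auto simp: eventually_sequentially)
    have le: "\<bar>kernel_op K (k n) y - k n y\<bar> \<le> d/2" if "M \<le> n" for n
      using that M by (intro hull_harmonic[OF k y]) (meson less_imp_le order_trans)
    show "\<forall>\<^sub>F n in sequentially. dist (kernel_op K (k n) y - k n y) 0 < d"
    proof (intro eventually_sequentiallyI[of M])
      fix n assume "M \<le> n"
      from le[OF this] \<open>0 < d\<close> show "dist (kernel_op K (k n) y - k n y) 0 < d" by (simp add: dist_real_def)
    qed
  qed
  \<comment> \<open>The default value \<open>0\<close> keeps \<open>h\<close> within the unit interval where the averages diverge.\<close>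
  define h where "h y = (if convergent (\<lambda>n. k n y) then lim (\<lambda>n. k n y) else 0)" for y
  have h_lim: "(\<lambda>n. k n y) \<longlonglongrightarrow> h y" if "convergent (\<lambda>n. k n y)" for y
    using that by (simp add: h_def convergent_LIMSEQ_iff)
  have [measurable]: "Measurable.pred S (\<lambda>y. convergent (\<lambda>n. k n y))"
    unfolding Cauchy_convergent_iff[symmetric] by measurable
  have h: "unit_valued S h"
  proof (rule unit_valuedI)
    show "h \<in> borel_measurable S" unfolding h_def[abs_def] by measurable
    fix y assume y: "y \<in> space S"
    show "0 \<le> h y"
    proof (cases "convergent (\<lambda>n. k n y)")
      case True
      from h_lim[OF this] show ?thesis
        by (rule LIMSEQ_le_const) (use unit_valuedD(2)[OF k_unit y] in auto)
    qed (simp add: h_def)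
    show "h y \<le> 1"
    proof (cases "convergent (\<lambda>n. k n y)")
      case True
      from h_lim[OF this] show ?thesis
        by (rule LIMSEQ_le_const2) (use unit_valuedD(3)[OF k_unit y] in auto)
    qed (simp add: h_def)
  qed
  have [measurable]: "h \<in> borel_measurable S" by (rule unit_valuedD[OF h])
  have conv_\<nu>: "AE y in \<nu> j. convergent (\<lambda>n. k n y)" for j
    using conv AE_m by auto
  have dominated: "(\<lambda>n. \<integral>y. k n y \<partial>M) \<longlonglongrightarrow> (\<integral>y. h y \<partial>M)"
    if M: "prob_space M" "sets M = sets S" and "AE y in M. convergent (\<lambda>n. k n y)" for M
  proof (rule integral_dominated_convergence[where w = "\<lambda>_. 1"])
    interpret prob_space M by fact
    show "integrable M (\<lambda>_. 1::real)" by simp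
    show "h \<in> borel_measurable M" "k n \<in> borel_measurable M" for n
      using M(2) by (simp_all add: measurable_cong_sets[OF M(2) refl])
    show "AE y in M. (\<lambda>n. k n y) \<longlonglongrightarrow> h y" using that(3) by eventually_elim (rule h_lim)
    show "AE y in M. norm (k n y) \<le> 1" for n
      using unit_valuedD(2,3)[OF k_unit] sets_eq_imp_space_eq[OF M(2)] by (intro AE_I2) auto
  qed
  have h_harmonic: "AE y in \<nu> j. kernel_op K h y = h y"
    if "AE y in \<nu> j. AE z in K y. convergent (\<lambda>n. k n z)" for j
    using that conv_\<nu> AE_space
  proof eventually_elim
    case (elim y)
    then have y: "y \<in> space S" using sets_eq_imp_space_eq[OF \<nu>(2)] by auto
    have "(\<lambda>n. kernel_op K (k n) y) \<longlonglongrightarrow> kernel_op K h y"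
      unfolding kernel_op_def by (rule dominated[OF prob_space_K[OF y] sets_K[OF y] elim(1)])
    from tendsto_diff[OF this h_lim[OF elim(2)]] k_harmonic[OF y] have "kernel_op K h y - h y = 0"
      using LIMSEQ_unique by blast
    then show ?case by simp
  qed
  define c where "c = (\<integral>y. h y \<partial>\<pi>)"
  have conv_pi: "AE y in \<pi>. convergent (\<lambda>n. k n y)"
    using conv_\<nu>[of 0] unfolding \<nu>_0 .
  then have "AE y in \<pi>. AE z in K y. convergent (\<lambda>n. k n z)"
    by (intro AE_pi_K) measurable
  then have "AE y in \<pi>. kernel_op K h y = h y"
    using h_harmonic[of 0] unfolding \<nu>_0 by blast
  then have "AE y in \<pi>. h y = c" unfolding c_def by (rule harmonic_AE_const[OF h])
  moreover have "{y \<in> space \<pi>. h y \<noteq> c} \<in> sets \<pi>" unfolding space_pi sets_pi by measurable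
  ultimately have "{y \<in> space \<pi>. \<not> h y = c} \<in> null_sets \<pi>"
    by (intro AE_iff_null[THEN iffD1])
  then have N: "{y \<in> space S. h y \<noteq> c} \<in> null_sets \<pi>" (is "?N \<in> _")
    by (simp add: space_pi)
  have marginal_const: "(\<integral>y. h y \<partial>marginal S K s j) = h s" for j
  proof (induction j)
    case 0
    show ?case using s by (simp add: integral_return)
  next
    case (Suc j)
    have "AE y in marginal S K s j. AE z in K y. convergent (\<lambda>n. k n z)"
      using conv_\<nu>[of "Suc (Suc j)"] unfolding \<nu>_Suc marginal.simps
      by (rule AE_bind_K[OF sets_marginal[OF s], rotated]) measurable
    then have "AE y in marginal S K s j. kernel_op K h y = h y"
      using h_harmonic[of "Suc j"] unfolding \<nu>_Suc by blast
    then have "(\<integral>y. kernel_op K h y \<partial>marginal S K s j) = (\<integral>y. h y \<partial>marginal S K s j)"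
      using unit_valuedD(1)[OF unit_valued_kernel_op[OF h]]
      by (intro integral_cong_AE) (auto simp: measurable_cong_sets[OF sets_marginal[OF s] refl])
    then show ?case
      using Suc by (simp add: integral_bind_K[OF h prob_space_marginal[OF s] sets_marginal[OF s]])
  qed
  have "h s \<le> c + measure (marginal S K s j) ?N" for j
  proof -
    interpret M: prob_space "marginal S K s j" using s by (rule prob_space_marginal)
    have N': "?N \<in> sets (marginal S K s j)" by (simp add: sets_marginal[OF s])
    have intN: "integrable (marginal S K s j) (indicator ?N :: 'a \<Rightarrow> real)"
      by (rule unit_valued_integrable[OF unit_valued_indicator M.prob_space_axioms sets_marginal[OF s]]) measurable
    have "h s = (\<integral>y. h y \<partial>marginal S K s j)" by (simp add: marginal_const)
    also have "\<dots> \<le> (\<integral>y. c + indicator ?N y \<partial>marginal S K s j)"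
    proof (rule integral_mono)
      show "integrable (marginal S K s j) h"
        by (rule unit_valued_integrable[OF h M.prob_space_axioms sets_marginal[OF s]])
      show "integrable (marginal S K s j) (\<lambda>y. c + indicator ?N y)"
        by (rule Bochner_Integration.integrable_add[OF M.integrable_const intN])
      have "0 \<le> c" unfolding c_def by (rule unit_valued_integral(1)[OF h prob_space_pi sets_pi])
      then show "h y \<le> c + indicator ?N y" if "y \<in> space (marginal S K s j)" for y
        using unit_valuedD(3)[OF h, of y] that by (cases "h y = c") (simp_all add: space_marginal[OF s])
    qed
    also have "\<dots> = c + measure (marginal S K s j) ?N"
      unfolding Bochner_Integration.integral_add[OF M.integrable_const intN]
      using sets.Int_space_eq2[OF N'] by (simp add: M.prob_space)
    finally show ?thesis .
  qed
  then have "h s \<le> c + 0"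
    by (intro LIMSEQ_le_const[OF tendsto_add[OF tendsto_const null_set_avoided[OF N s]]]) auto
  moreover have "e \<le> h s - c"
  proof (rule LIMSEQ_le_const)
    have "convergent (\<lambda>n. k n s)"
      using conv_\<nu>[of "Suc 0"] s unfolding \<nu>_Suc marginal.simps by (subst (asm) AE_return) auto
    moreover have "(\<lambda>n. \<integral>y. k n y \<partial>\<pi>) \<longlonglongrightarrow> c"
      unfolding c_def by (rule dominated[OF prob_space_pi sets_pi conv_pi])
    ultimately show "(\<lambda>n. k n s - (\<integral>y. k n y \<partial>\<pi>)) \<longlonglongrightarrow> h s - c"
      by (intro tendsto_diff h_lim)
    show "\<exists>N. \<forall>n\<ge>N. e \<le> k n s - (\<integral>y. k n y \<partial>\<pi>)" using hull_gap[OF k] by blast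
  qed
  ultimately show False using e by simp
qed

text \<open>
  The other half follows by passing to \<open>1 - g\<close>.
\<close>

lemma asymptotically_harmonic_imp_const:
  assumes g: "\<And>n. unit_valued S (g n)"
    and harmonic: "\<And>y. y \<in> space S \<Longrightarrow> (\<lambda>n. kernel_op K (g n) y - g n y) \<longlonglongrightarrow> 0"
    and s: "s \<in> space S"
  shows "(\<lambda>n. g n s - (\<integral>y. g n y \<partial>\<pi>)) \<longlonglongrightarrow> 0"
proof (rule tendstoI)
  fix e :: real assume e: "0 < e"
  interpret prob_space \<pi> by (rule prob_space_pi)
  have flip: "(\<lambda>n. kernel_op K (\<lambda>y. 1 - g n y) y - (1 - g n y)) \<longlonglongrightarrow> 0" if "y \<in> space S" for y
    using tendsto_minus[OF harmonic[OF that]] that by (simp add: kernel_op_1_minus[OF g])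
  have "\<forall>\<^sub>F n in sequentially. 1 - g n s - (\<integral>y. 1 - g n y \<partial>\<pi>) < e"
    by (rule asymptotically_harmonic_upper[OF unit_valued_1_minus[OF g] flip s e])
  then have "\<forall>\<^sub>F n in sequentially. (\<integral>y. g n y \<partial>\<pi>) - g n s < e"
    by (simp add: integrable_pi[OF g] prob_space)
  moreover have "\<forall>\<^sub>F n in sequentially. g n s - (\<integral>y. g n y \<partial>\<pi>) < e"
    by (rule asymptotically_harmonic_upper[OF g harmonic s e])
  ultimately show "\<forall>\<^sub>F n in sequentially. dist (g n s - (\<integral>y. g n y \<partial>\<pi>)) 0 < e"
    by eventually_elim (simp add: dist_real_def abs_less_iff)
qed

end

section \<open>Survival in sets of nearly full measure\<close>

context harris_kernel
begin

text \<open>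
  The probability \<open>v\<close> of never leaving \<open>B\<close> satisfies \<open>v \<le> K v\<close>; since both sides have the same
  \<open>\<pi>\<close>-mean, \<open>v\<close> is harmonic almost everywhere and hence constant. It vanishes off \<open>B\<close>.
\<close>

lemma stationary_survival_tendsto_0:
  assumes B: "B \<in> sets S" and exit: "measure \<pi> (space S - B) > 0"
  shows "stationary_survival B \<longlonglongrightarrow> 0"
proof -
  note u = unit_valued_survival[OF B]
  have [measurable]: "survival K B n \<in> borel_measurable S" for n by (rule unit_valuedD[OF u])
  define v where "v y = lim (\<lambda>n. survival K B n y)" for y
  have v_lim: "(\<lambda>n. survival K B n y) \<longlonglongrightarrow> v y" if y: "y \<in> space S" for y
  proof -
    obtain l where "(\<lambda>n. survival K B n y) \<longlonglongrightarrow> l"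
      using decseq_convergent[OF survival_antimono[OF B y], of 0] unit_valuedD(2)[OF u y] by blast
    then show ?thesis by (simp add: v_def limI)
  qed
  have v: "unit_valued S v"
  proof (rule unit_valuedI)
    show "v \<in> borel_measurable S" unfolding v_def[abs_def] by measurable
    show "0 \<le> v y" if "y \<in> space S" for y
      by (rule LIMSEQ_le_const[OF v_lim[OF that]]) (use unit_valuedD(2)[OF u that] in auto)
    show "v y \<le> 1" if "y \<in> space S" for y
      by (rule LIMSEQ_le_const2[OF v_lim[OF that]]) (use unit_valuedD(3)[OF u that] in auto)
  qed
  have dominated: "(\<lambda>n. \<integral>y. survival K B n y \<partial>M) \<longlonglongrightarrow> (\<integral>y. v y \<partial>M)"
    if M: "prob_space M" "sets M = sets S" for M
  proof (rule integral_dominated_convergence[where w = "\<lambda>_. 1"])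
    interpret prob_space M by fact
    have sp: "space M = space S" using M(2) by (rule sets_eq_imp_space_eq)
    show "integrable M (\<lambda>_. 1::real)" by simp
    show "v \<in> borel_measurable M" "survival K B n \<in> borel_measurable M" for n
      using unit_valuedD(1)[OF v] by (simp_all add: measurable_cong_sets[OF M(2) refl])
    show "AE y in M. (\<lambda>n. survival K B n y) \<longlonglongrightarrow> v y" by (intro AE_I2 v_lim) (simp add: sp)
    show "AE y in M. norm (survival K B n y) \<le> 1" for n
      using unit_valuedD(2,3)[OF u] sp by (intro AE_I2) auto
  qed
  have fixpoint: "v y = indicator B y * kernel_op K v y" if y: "y \<in> space S" for y
  proof -
    have "(\<lambda>n. survival K B (Suc n) y) \<longlonglongrightarrow> indicator B y * kernel_op K v y"
      unfolding survival.simps kernel_op_def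
      by (intro tendsto_mult tendsto_const dominated prob_space_K sets_K y)
    with LIMSEQ_Suc[OF v_lim[OF y]] show ?thesis by (rule LIMSEQ_unique)
  qed
  note Pv = unit_valued_kernel_op[OF v]
  have "AE y in \<pi>. kernel_op K v y - v y = 0"
  proof (subst integral_nonneg_eq_0_iff_AE[symmetric])
    show "integrable \<pi> (\<lambda>y. kernel_op K v y - v y)"
      by (rule Bochner_Integration.integrable_diff[OF integrable_pi[OF Pv] integrable_pi[OF v]])
    show "AE y in \<pi>. 0 \<le> kernel_op K v y - v y"
      using fixpoint unit_valuedD(2)[OF Pv] by (intro AE_I2) (auto simp: space_pi indicator_def)
    show "(\<integral>y. kernel_op K v y - v y \<partial>\<pi>) = 0"
      by (simp add: integrable_pi[OF Pv] integrable_pi[OF v] integral_kernel_op[OF v])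
  qed
  then have "AE y in \<pi>. kernel_op K v y = v y" by eventually_elim simp
  then have const: "AE y in \<pi>. v y = (\<integral>y. v y \<partial>\<pi>)" by (rule harmonic_AE_const[OF v])
  have "(\<integral>y. v y \<partial>\<pi>) = 0"
  proof (rule ccontr)
    assume nonzero: "(\<integral>y. v y \<partial>\<pi>) \<noteq> 0"
    from const AE_space have "AE y in \<pi>. y \<in> B"
    proof eventually_elim
      case (elim y)
      with fixpoint[of y] nonzero show ?case by (auto simp: space_pi indicator_def split: if_splits)
    qed
    then have "AE y in \<pi>. y \<notin> space S - B" by eventually_elim simp
    then have "measure \<pi> (space S - B) = 0"
      using B by (subst (asm) AE_iff_null_sets[symmetric]) (auto simp: sets_pi measure_def null_setsD1)
    with exit show False by simp
  qed
  with dominated[OF prob_space_pi sets_pi] show ?thesis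
    by (simp add: stationary_survival_def[abs_def])
qed

text \<open>
  A single survival probability need not be almost harmonic at \<open>s\<close>: the defect is the probability of
  leaving \<open>B k\<close> at one precise late time. Averaging over a window of \<open>L\<close> consecutive horizons reduces the
  defect to \<open>1 / L\<close>, while the \<open>\<pi>\<close>-means in the window differ by at most \<open>L * p\<close> with \<open>p\<close> the mass
  outside \<open>B k\<close>. Both errors vanish for \<open>L \<approx> 1 / sqrt p\<close>. Windows on both sides of the horizon
  bound the survival probability from below and from above.
\<close>

lemma survival_forgets_start:
  assumes B: "\<And>k. B k \<in> sets S" and exit: "\<And>k. measure \<pi> (B k) < 1"
    and rare: "(\<lambda>k. measure \<pi> (B k)) \<longlonglongrightarrow> 1"
    and exhaust: "\<And>y. y \<in> space S \<Longrightarrow> \<forall>\<^sub>F k in sequentially. y \<in> B k"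
    and s: "s \<in> space S"
  shows "(\<lambda>k. survival K (B k) (n k) s - stationary_survival (B k) (n k)) \<longlonglongrightarrow> 0"
proof -
  define p where "p k = 1 - measure \<pi> (B k)" for k
  have p_pos: "0 < p k" for k using exit[of k] by (simp add: p_def)
  have p: "p \<longlonglongrightarrow> 0" unfolding p_def using tendsto_diff[OF tendsto_const[of 1] rare] by simp
  define L where "L k = nat \<lceil>1 / sqrt (p k)\<rceil>" for k
  have L_pos: "0 < L k" for k using p_pos[of k] by (simp add: L_def)
  have L_ge: "1 / real (L k) \<le> sqrt (p k)" for k
  proof -
    have "1 / sqrt (p k) \<le> real (L k)" unfolding L_def by (rule real_nat_ceiling_ge)
    with p_pos[of k] L_pos[of k] show ?thesis by (simp add: field_simps)
  qed
  have Lp_le: "real (L k) * p k \<le> sqrt (p k) + p k" for k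
  proof -
    have "real (L k) \<le> 1 / sqrt (p k) + 1" using p_pos[of k] unfolding L_def by simp
    then have "real (L k) * p k \<le> (1 / sqrt (p k) + 1) * p k"
      using p_pos[of k] by (intro mult_right_mono) auto
    also have "\<dots> = sqrt (p k) + p k"
      using p_pos[of k] by (simp add: field_simps real_div_sqrt)
    finally show ?thesis .
  qed
  have sqrt_p: "(\<lambda>k. sqrt (p k)) \<longlonglongrightarrow> 0" using tendsto_real_sqrt[OF p] by simp
  have "(\<lambda>k. real (L k) * p k) \<longlonglongrightarrow> 0"
  proof (rule tendsto_sandwich[OF _ _ tendsto_const])
    show "(\<lambda>k. sqrt (p k) + p k) \<longlonglongrightarrow> 0" using tendsto_add[OF sqrt_p p] by simp
  qed (auto intro!: always_eventually mult_nonneg_nonneg less_imp_le[OF p_pos] Lp_le)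
  note Lp = this
  note u = unit_valued_survival[OF B]
  define C where "C a k y = (\<Sum>l<L k. survival K (B k) (a k + l) y) / real (L k)" for a k y
  have C_unit: "unit_valued S (C a k)" for a k
  proof (rule unit_valuedI)
    have [measurable]: "survival K (B k) n \<in> borel_measurable S" for n by (rule unit_valuedD[OF u])
    show "C a k \<in> borel_measurable S" unfolding C_def[abs_def] by measurable
    fix y assume y: "y \<in> space S"
    show "0 \<le> C a k y" unfolding C_def by (intro divide_nonneg_nonneg sum_nonneg unit_valuedD(2)[OF u y]) auto
    have "(\<Sum>l<L k. survival K (B k) (a k + l) y) \<le> (\<Sum>l<L k. 1)"
      by (intro sum_mono unit_valuedD(3)[OF u y])
    then show "C a k y \<le> 1" using L_pos[of k] by (simp add: C_def)
  qed
  have C_mean: "(\<integral>y. C a k y \<partial>\<pi>) = (\<Sum>l<L k. stationary_survival (B k) (a k + l)) / real (L k)" for a k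
    by (simp add: C_def stationary_survival_def integral_sum integrable_pi[OF u])
  have C_const: "(\<lambda>k. C a k s - (\<integral>y. C a k y \<partial>\<pi>)) \<longlonglongrightarrow> 0" for a
  proof (rule asymptotically_harmonic_imp_const[OF C_unit _ s])
    fix y assume y: "y \<in> space S"
    have "\<forall>\<^sub>F k in sequentially. norm (kernel_op K (C a k) y - C a k y) \<le> sqrt (p k)"
      using exhaust[OF y]
    proof eventually_elim
      case (elim k)
      let ?u = "\<lambda>l. survival K (B k) (a k + l) y"
      have "kernel_op K (C a k) y = (\<Sum>l<L k. ?u (Suc l)) / real (L k)"
        using elim by (simp add: C_def kernel_op_def integral_sum integrable_K[OF u y])
      then have "kernel_op K (C a k) y - C a k y = (\<Sum>l<L k. ?u (Suc l) - ?u l) / real (L k)"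
        by (simp only: C_def sum_subtractf diff_divide_distrib)
      also have "(\<Sum>l<L k. ?u (Suc l) - ?u l) = ?u (L k) - ?u 0" by (rule sum_lessThan_telescope)
      finally have "\<bar>kernel_op K (C a k) y - C a k y\<bar> = \<bar>?u (L k) - ?u 0\<bar> / real (L k)" by simp
      also have "\<bar>?u (L k) - ?u 0\<bar> \<le> 1"
        using unit_valuedD(2,3)[OF u y, of k "a k + L k"] unit_valuedD(2,3)[OF u y, of k "a k + 0"] by linarith
      then have "\<bar>?u (L k) - ?u 0\<bar> / real (L k) \<le> 1 / real (L k)" by (rule divide_right_mono) simp
      also note L_ge
      finally show ?case by simp
    qed
    then show "(\<lambda>k. kernel_op K (C a k) y - C a k y) \<longlonglongrightarrow> 0" by (rule Lim_null_comparison[OF _ sqrt_p])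
  qed
  \<comment> \<open>Truncated subtraction: a horizon shorter than the window is treated separately below, since then
      the stationary survival probability is close to one.\<close>
  define a where "a k = n k - L k" for k
  define err where "err k = \<bar>C n k s - (\<integral>y. C n k y \<partial>\<pi>)\<bar> + \<bar>C a k s - (\<integral>y. C a k y \<partial>\<pi>)\<bar> + real (L k) * p k" for k
  have "err \<longlonglongrightarrow> 0 + 0 + 0"
    unfolding err_def by (intro tendsto_add tendsto_rabs_zero C_const Lp)
  then have err: "err \<longlonglongrightarrow> 0" by simp
  have avg_le: "(\<Sum>l<L k. g l) / real (L k) \<le> c" if "\<And>l. l < L k \<Longrightarrow> g l \<le> c" for g c k
    using sum_bounded_above[of "{..<L k}" g c] that L_pos[of k] by (simp add: divide_le_eq mult.commute)
  have le_avg: "c \<le> (\<Sum>l<L k. g l) / real (L k)" if "\<And>l. l < L k \<Longrightarrow> c \<le> g l" for g c k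
    using sum_bounded_below[of "{..<L k}" c g] that L_pos[of k] by (simp add: le_divide_eq mult.commute)
  have "\<bar>survival K (B k) (n k) s - stationary_survival (B k) (n k)\<bar> \<le> err k" for k
  proof -
    note jump = stationary_survival_jump[OF B, of k, folded p_def]
    note surv_mono = antimonoD[OF survival_antimono[OF B s]] and stat_mono = antimonoD[OF stationary_survival_antimono[OF B]]
    have Lp_nn: "0 \<le> real (L k) * p k" using p_pos[of k] by simp
    have "C n k s \<le> survival K (B k) (n k) s"
      unfolding C_def by (intro avg_le surv_mono) simp
    moreover have "stationary_survival (B k) (n k) - real (L k) * p k \<le> (\<integral>y. C n k y \<partial>\<pi>)"
      unfolding C_mean
    proof (rule le_avg)
      fix l assume "l < L k"
      then have "real l * p k \<le> real (L k) * p k" using p_pos[of k] by (intro mult_right_mono) auto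
      with jump[of "n k" l] show "stationary_survival (B k) (n k) - real (L k) * p k \<le> stationary_survival (B k) (n k + l)"
        by linarith
    qed
    ultimately have lower: "stationary_survival (B k) (n k) - survival K (B k) (n k) s \<le> err k"
      unfolding err_def by linarith
    have upper: "survival K (B k) (n k) s - stationary_survival (B k) (n k) \<le> err k"
    proof (cases "L k \<le> n k")
      case True
      then have "survival K (B k) (n k) s \<le> C a k s"
        unfolding C_def a_def by (intro le_avg surv_mono) simp
      moreover have "(\<integral>y. C a k y \<partial>\<pi>) \<le> stationary_survival (B k) (a k)"
        unfolding C_mean by (intro avg_le stat_mono) simp
      moreover have "stationary_survival (B k) (a k) - real (L k) * p k \<le> stationary_survival (B k) (n k)"
        using jump[of "a k" "L k"] True by (simp add: a_def)
      ultimately show ?thesis unfolding err_def by linarith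
    next
      case False
      then have "real (n k) * p k \<le> real (L k) * p k" using p_pos[of k] by (intro mult_right_mono) auto
      moreover have "1 - real (n k) * p k \<le> stationary_survival (B k) (n k)"
        using jump[of 0 "n k"] by (simp add: stationary_survival_0)
      ultimately show ?thesis
        using unit_valuedD(3)[OF u s, of k "n k"] unfolding err_def by linarith
    qed
    from lower upper show ?thesis by linarith
  qed
  then show ?thesis by (intro Lim_null_comparison[OF always_eventually err] allI) simp
qed

text \<open>
  After \<open>m\<close> steps the chain has forgotten its position, so that the remaining \<open>n\<close> steps contribute an
  independent factor; stationarity makes the law of \<open>Y\<^sub>m\<close> equal to \<open>\<pi>\<close> whatever \<open>m\<close> is.
\<close>

lemma stationary_survival_asymptotically_multiplicative:
  assumes B: "\<And>k. B k \<in> sets S" and exit: "\<And>k. measure \<pi> (B k) < 1"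
    and rare: "(\<lambda>k. measure \<pi> (B k)) \<longlonglongrightarrow> 1"
    and exhaust: "\<And>y. y \<in> space S \<Longrightarrow> \<forall>\<^sub>F k in sequentially. y \<in> B k"
  shows "(\<lambda>k. stationary_survival (B k) (m k + n k)
    - stationary_survival (B k) (m k) * stationary_survival (B k) (n k)) \<longlonglongrightarrow> 0"
proof -
  interpret prob_space \<pi> by (rule prob_space_pi)
  define d where "d k s = \<bar>survival K (B k) (n k) s - stationary_survival (B k) (n k)\<bar>" for k s
  have d: "unit_valued S (d k)" for k
    unfolding d_def
    by (intro unit_valued_abs_diff unit_valued_survival unit_valued_const stationary_survival_bounds B)
  have "(\<lambda>k. \<integral>s. d k s \<partial>\<pi>) \<longlonglongrightarrow> (\<integral>s. 0 \<partial>\<pi>)"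
  proof (rule integral_dominated_convergence[where w = "\<lambda>_. 1"])
    show "d k \<in> borel_measurable \<pi>" for k
      using unit_valuedD(1)[OF d] by (simp add: measurable_cong_sets[OF sets_pi refl])
    show "AE s in \<pi>. (\<lambda>k. d k s) \<longlonglongrightarrow> 0"
      unfolding d_def using survival_forgets_start[OF B exit rare exhaust]
      by (intro AE_I2 tendsto_rabs_zero) (simp add: space_pi)
    show "AE s in \<pi>. norm (d k s) \<le> 1" for k
      using unit_valuedD(2,3)[OF d] by (intro AE_I2) (auto simp: space_pi)
  qed auto
  then have "(\<lambda>k. \<integral>s. d k s \<partial>\<pi>) \<longlonglongrightarrow> 0" by simp
  then show ?thesis
  proof (rule Lim_null_comparison[OF always_eventually, rotated], intro allI)
    fix k
    show "norm (stationary_survival (B k) (m k + n k)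
        - stationary_survival (B k) (m k) * stationary_survival (B k) (n k)) \<le> (\<integral>s. d k s \<partial>\<pi>)"
      unfolding d_def real_norm_def by (rule stationary_survival_add[OF B])
  qed
qed

end

section \<open>Maxima of functions of the chain\<close>

lemma chain_max_le_eq_survival:
  assumes K: "transition_kernel S K" and s: "s \<in> space S" and f[measurable]: "f \<in> borel_measurable S" and n: "0 < n"
  shows "\<P>(\<omega> in chain_law S K s. chain_max f n \<omega> \<le> x) = survival K {y \<in> space S. f y \<le> x} n s"
proof -
  interpret markov_kernel S K by unfold_locales (rule K)
  have "space (chain_law S K s) = space (PiM UNIV (\<lambda>_. S))"
    by (rule sets_eq_imp_space_eq[OF sets_chain_law[OF K s]])
  then have "{\<omega> \<in> space (chain_law S K s). chain_max f n \<omega> \<le> x}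
      = {\<omega> \<in> space (chain_law S K s). \<forall>j<n. \<omega> j \<in> {y \<in> space S. f y \<le> x}}"
    using n by (auto simp: chain_max_def Max_le_iff space_PiM lessThan_empty_iff)
  then show ?thesis using chain_law_stays[OF s, of "{y \<in> space S. f y \<le> x}" n] by simp
qed

text \<open>
  Uniformity in \<open>x\<close> is an issue only at high levels: below a fixed level \<open>x0\<close> both quantities are
  bounded by their values at \<open>x0\<close>, which tend to \<open>0\<close>.
\<close>

lemma uniform_convergence_of_maxima:
  fixes U :: "nat \<Rightarrow> real \<Rightarrow> real" and G :: "real \<Rightarrow> real"
  assumes U_mono: "\<And>n. mono (U n)" and U: "\<And>n x. 0 \<le> U n x" "\<And>n x. U n x \<le> 1"
    and G_mono: "mono G" and G: "\<And>x. 0 \<le> G x" "\<And>x. G x < 1"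
    and tail: "\<And>X n. filterlim X at_top sequentially \<Longrightarrow> (\<lambda>k. U (n k) (X k) - G (X k) ^ n k) \<longlonglongrightarrow> 0"
  shows "(\<lambda>n. SUP x. \<bar>U n x - G x ^ n\<bar>) \<longlonglongrightarrow> 0"
proof -
  have G_pow: "0 \<le> G x ^ n" "G x ^ n \<le> 1" for x n
    using G[of x] by (auto intro: power_le_one less_imp_le)
  have diff_le_1: "\<bar>U n x - G x ^ n\<bar> \<le> 1" for n x
    using U[of n x] G_pow[of x n] by linarith
  have far: "\<exists>x0. \<forall>x\<ge>x0. \<forall>n. \<bar>U n x - G x ^ n\<bar> \<le> e" if e: "0 < e" for e
  proof (rule ccontr)
    assume "\<not> ?thesis"
    then have "\<forall>k::nat. \<exists>x n. real k \<le> x \<and> e < \<bar>U n x - G x ^ n\<bar>" by (auto simp: not_le)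
    then obtain X n where X: "\<And>k. real k \<le> X k" and bad: "\<And>k. e < \<bar>U (n k) (X k) - G (X k) ^ n k\<bar>" by metis
    have "filterlim X at_top sequentially"
      by (rule filterlim_at_top_mono[OF filterlim_real_sequentially always_eventually]) (use X in simp)
    from tendstoD[OF tail[OF this] e, of n]
    have "\<forall>\<^sub>F k in sequentially. \<bar>U (n k) (X k) - G (X k) ^ n k\<bar> < e" by (simp add: dist_real_def)
    then obtain k where "\<bar>U (n k) (X k) - G (X k) ^ n k\<bar> < e"
      by (blast dest: eventually_happens'[OF sequentially_bot])
    with bad[of k] show False by simp
  qed
  show ?thesis
  proof (rule tendstoI)
    fix e :: real assume e: "0 < e"
    obtain x0 where x0: "\<And>x n. x0 \<le> x \<Longrightarrow> \<bar>U n x - G x ^ n\<bar> \<le> e/4" using far[of "e/4"] e by auto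
    have "(\<lambda>n. G x0 ^ n) \<longlonglongrightarrow> 0" using G by (intro LIMSEQ_realpow_zero) auto
    then have "\<forall>\<^sub>F n in sequentially. G x0 ^ n < e/4" using e by (intro order_tendstoD) auto
    then show "\<forall>\<^sub>F n in sequentially. dist (SUP x. \<bar>U n x - G x ^ n\<bar>) 0 < e"
    proof eventually_elim
      case (elim n)
      have "\<bar>U n x - G x ^ n\<bar> \<le> e/2" for x
      proof (cases "x0 \<le> x")
        case True
        with x0[OF True, of n] e show ?thesis by linarith
      next
        case False
        then have "U n x \<le> U n x0" "G x ^ n \<le> G x0 ^ n"
          using monoD[OF U_mono, of x x0 n] monoD[OF G_mono, of x x0] G(1)[of x] by (auto intro: power_mono)
        moreover have "U n x0 \<le> G x0 ^ n + e/4" using x0[OF order_refl, of n] by linarith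
        ultimately show ?thesis using elim U(1)[of n x] G_pow(1)[of x n] by linarith
      qed
      then have "(SUP x. \<bar>U n x - G x ^ n\<bar>) \<le> e/2" by (intro cSUP_least) auto
      moreover have "\<bar>U n 0 - G 0 ^ n\<bar> \<le> (SUP x. \<bar>U n x - G x ^ n\<bar>)"
        using diff_le_1 by (intro cSUP_upper) (auto intro!: bdd_aboveI2)
      ultimately show ?case using e by (simp add: dist_real_def)
    qed
  qed
qed

theorem theorem2:
  fixes S :: "'a measure" and K :: "'a \<Rightarrow> 'a measure" and \<pi> :: "'a measure" and f :: "'a \<Rightarrow> real"
  assumes "transition_kernel S K"
    and "positive_harris S K"
    and "stationary_distribution S K \<pi>"
    and "aperiodic S K \<pi>"
    and "f \<in> borel_measurable S"
    and "continuous_on UNIV (cdf (distr \<pi> borel f))"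
    and "\<forall>x. measure \<pi> {s \<in> space S. f s > x} > 0"
  shows "\<exists>\<nu>. real_distribution \<nu> \<and> continuous_on UNIV (cdf \<nu>) \<and>
           (\<forall>s\<in>space S.
              (\<lambda>n. SUP x::real. \<bar>\<P>(\<omega> in chain_law S K s. chain_max f n \<omega> \<le> x) - cdf \<nu> x ^ n\<bar>)
                \<longlonglongrightarrow> 0)"
proof -
  interpret markov_kernel S K by unfold_locales (rule assms(1))
  obtain \<phi> where \<phi>: "sets \<phi> = sets S" "emeasure \<phi> (space S) > 0"
    and visits: "\<And>A s. A \<in> sets S \<Longrightarrow> emeasure \<phi> A > 0 \<Longrightarrow> s \<in> space S \<Longrightarrow>
      AE \<omega> in chain_law S K s. infinite {n. \<omega> n \<in> A}"
    using assms(2) unfolding positive_harris_def harris_recurrent_def by blast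
  interpret harris_kernel S K \<pi> \<phi>
    by unfold_locales (use assms(3) \<phi> visits in \<open>auto intro: visited_imp_survival_tendsto_0\<close>)
  interpret prob_space \<pi> by (rule prob_space_pi)
  have f[measurable]: "f \<in> borel_measurable S" by (rule assms(5))
  have f_pi[measurable]: "f \<in> borel_measurable \<pi>"
    using f by (simp add: measurable_cong_sets[OF sets_pi refl])
  define B where "B x = {y \<in> space S. f y \<le> x}" for x
  have B: "B x \<in> sets S" for x unfolding B_def by measurable
  have B_mono: "B x \<subseteq> B y" if "x \<le> y" for x y using that by (auto simp: B_def)
  define F where "F x = measure \<pi> (B x)" for x
  define Q where "Q n x = stationary_survival (B x) n" for n x
  interpret D: real_distribution "distr \<pi> borel f"
    by (rule real_distribution_distr) simp
  have F_cdf: "F = cdf (distr \<pi> borel f)"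
  proof
    fix x
    have "f -` {..x} \<inter> space \<pi> = B x" by (auto simp: B_def space_pi)
    then show "F x = cdf (distr \<pi> borel f) x" by (simp add: F_def cdf_def measure_distr)
  qed
  have F_cont: "isCont F x" for x
    using assms(6) by (simp add: F_cdf continuous_on_eq_continuous_at)
  have F_top: "(F \<longlongrightarrow> 1) at_top" unfolding F_cdf by (rule D.cdf_lim_at_top_prob)
  have F_bot: "(F \<longlongrightarrow> 0) at_bot" unfolding F_cdf by (rule D.cdf_lim_at_bot)
  have exit: "measure \<pi> (space S - B x) > 0" for x
  proof -
    have "space S - B x = {s \<in> space S. f s > x}" by (auto simp: B_def)
    then show ?thesis using assms(7) by simp
  qed
  have F_less_1: "F x < 1" for x
    using exit[of x] prob_compl[of "B x"] B[of x] by (simp add: F_def sets_pi space_pi)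
  have Q_mono: "Q n x \<le> Q n y" if "x \<le> y" for n x y
    unfolding Q_def by (rule stationary_survival_mono_set[OF B B B_mono[OF that]])
  have Q_1: "Q 1 x = F x" for x
    using stationary_survival_1[OF B] by (simp add: Q_def F_def)
  have Q_jump: "Q a x - Q (a + l) x \<le> real l * (1 - F x)" for a l x
    unfolding Q_def F_def by (rule stationary_survival_jump[OF B])
  have Q_diff: "\<bar>Q n y - Q n x\<bar> \<le> real n * \<bar>F y - F x\<bar>" for n x y
  proof -
    have le: "\<bar>Q n y - Q n x\<bar> \<le> real n * \<bar>F y - F x\<bar>" if "x \<le> y" for x y
    proof -
      have "Q n y - Q n x \<le> real n * (F y - F x)"
        unfolding Q_def F_def by (rule stationary_survival_diff_le[OF B B B_mono[OF that]])
      also have "\<dots> \<le> real n * \<bar>F y - F x\<bar>" by (intro mult_left_mono) auto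
      finally show ?thesis using Q_mono[OF that, of n] by simp
    qed
    from le[of x y] le[of y x] show ?thesis by (cases "x \<le> y") (simp_all add: abs_minus_commute)
  qed
  have below_1: "measure \<pi> (B x) < 1" for x using F_less_1 by (simp add: F_def)
  have levels: "(\<lambda>k. measure \<pi> (B (X k))) \<longlonglongrightarrow> 1" if X: "filterlim X at_top sequentially" for X
    using filterlim_compose[OF F_top X] by (simp add: F_def)
  have exhaust: "\<forall>\<^sub>F k in sequentially. y \<in> B (X k)" if X: "filterlim X at_top sequentially" and y: "y \<in> space S" for X y
    using filterlim_at_top[THEN iffD1, OF X, rule_format, of "f y"] by eventually_elim (simp add: B_def y)
  obtain G where G_mono: "mono G" and G_cont: "continuous_on UNIV G"
    and G_bot: "(G \<longlongrightarrow> 0) at_bot" and G_top: "(G \<longlongrightarrow> 1) at_top"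
    and G: "\<And>x. 0 \<le> G x" "\<And>x. G x < 1"
    and phantom: "\<And>X n. filterlim X at_top sequentially \<Longrightarrow> (\<lambda>k. Q (n k) (X k) - G (X k) ^ n k) \<longlonglongrightarrow> 0"
  proof (rule phantom_distribution_function[of Q])
    show "antimono (\<lambda>n. Q n x)" for x
      unfolding Q_def by (rule stationary_survival_antimono[OF B])
    show "mono (Q n)" for n by (rule monoI) (rule Q_mono)
    show "0 \<le> Q n x" for n x unfolding Q_def by (rule stationary_survival_bounds[OF B])
    show "Q 0 x = 1" for x unfolding Q_def by (rule stationary_survival_0)
    show "continuous_on UNIV (Q n)" for n
    proof (intro continuous_at_imp_continuous_on ballI)
      fix x
      have "((\<lambda>y. real n * \<bar>F y - F x\<bar>) \<longlongrightarrow> real n * \<bar>F x - F x\<bar>) (at x)"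
        using F_cont[of x] by (intro tendsto_intros) (simp add: isCont_def)
      then have lim: "((\<lambda>y. real n * \<bar>F y - F x\<bar>) \<longlongrightarrow> 0) (at x)" by simp
      have "((\<lambda>y. Q n y - Q n x) \<longlongrightarrow> 0) (at x)"
        by (rule Lim_null_comparison[OF always_eventually lim]) (unfold real_norm_def, intro allI Q_diff)
      then show "isCont (Q n) x" by (simp add: isCont_def LIM_zero_iff)
    qed
    show "(Q n \<longlongrightarrow> 1) at_top" for n
    proof (rule tendsto_sandwich[OF _ _ _ tendsto_const])
      have "((\<lambda>x. 1 - real n * (1 - F x)) \<longlongrightarrow> 1 - real n * (1 - 1)) at_top"
        by (intro tendsto_intros F_top)
      then show "((\<lambda>x. 1 - real n * (1 - F x)) \<longlongrightarrow> 1) at_top" by simp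
      show "\<forall>\<^sub>F x in at_top. 1 - real n * (1 - F x) \<le> Q n x"
        using Q_jump[of 0 _ n] by (auto simp: Q_def stationary_survival_0 algebra_simps intro!: always_eventually)
      show "\<forall>\<^sub>F x in at_top. Q n x \<le> 1"
        unfolding Q_def using stationary_survival_bounds[OF B] by (auto intro!: always_eventually)
    qed
    have "Q 1 = F" by (rule ext) (rule Q_1)
    with F_bot show "(Q 1 \<longlongrightarrow> 0) at_bot" by (simp only:)
    show "(\<lambda>n. Q n x) \<longlonglongrightarrow> 0" for x
      unfolding Q_def by (rule stationary_survival_tendsto_0[OF B exit])
    show "Q n x - Q (Suc n) x \<le> 1 - Q 1 x" for n x
      using Q_jump[of n x 1] by (simp only: Q_1) simp
    show "(\<lambda>k. Q (m k + n k) (X k) - Q (m k) (X k) * Q (n k) (X k)) \<longlonglongrightarrow> 0"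
      if X: "filterlim X at_top sequentially" for X m n
      unfolding Q_def
      by (rule stationary_survival_asymptotically_multiplicative[OF B below_1 levels[OF X] exhaust[OF X]])
  qed blast
  show ?thesis
  proof (intro exI conjI ballI)
    have right: "continuous (at_right a) G" for a
      using G_cont by (simp add: continuous_on_eq_continuous_at continuous_at_imp_continuous_at_within)
    show "real_distribution (interval_measure G)"
      by (rule real_distribution_interval_measure[OF monoD[OF G_mono] right G_bot G_top])
    have cdf: "cdf (interval_measure G) = G"
      by (rule cdf_interval_measure[OF monoD[OF G_mono] right G_bot])
    show "continuous_on UNIV (cdf (interval_measure G))" using G_cont by (simp add: cdf)
    fix s assume s: "s \<in> space S"
    have "(\<lambda>n. SUP x. \<bar>survival K (B x) n s - G x ^ n\<bar>) \<longlonglongrightarrow> 0"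
    proof (rule uniform_convergence_of_maxima[OF _ _ _ G_mono G])
      show "mono (\<lambda>x. survival K (B x) n s)" for n
        by (intro monoI survival_mono_set B B_mono s)
      show "0 \<le> survival K (B x) n s" "survival K (B x) n s \<le> 1" for n x
        by (rule unit_valuedD(2,3)[OF unit_valued_survival[OF B] s])+
      show "(\<lambda>k. survival K (B (X k)) (n k) s - G (X k) ^ n k) \<longlonglongrightarrow> 0"
        if X: "filterlim X at_top sequentially" for X n
      proof -
        have "(\<lambda>k. survival K (B (X k)) (n k) s - Q (n k) (X k)) \<longlonglongrightarrow> 0"
          unfolding Q_def
          by (rule survival_forgets_start[OF B below_1 levels(1)[OF X] exhaust[OF X] s])
        from tendsto_add[OF this phantom[OF X, of n]] show ?thesis by simp
      qed
    qed
    \<comment> \<open>At \<open>n = 0\<close> the maximum ranges over the empty set, so the two suprema are compared for \<open>n > 0\<close>.\<close>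
    moreover have "\<forall>\<^sub>F n in sequentially. (SUP x. \<bar>survival K (B x) n s - G x ^ n\<bar>)
        = (SUP x. \<bar>\<P>(\<omega> in chain_law S K s. chain_max f n \<omega> \<le> x) - cdf (interval_measure G) x ^ n\<bar>)"
      using eventually_gt_at_top[of 0]
      by eventually_elim (simp add: chain_max_le_eq_survival[OF kernel s f] B_def cdf)
    ultimately show "(\<lambda>n. SUP x. \<bar>\<P>(\<omega> in chain_law S K s. chain_max f n \<omega> \<le> x) - cdf (interval_measure G) x ^ n\<bar>) \<longlonglongrightarrow> 0"
      by (rule Lim_transform_eventually)
  qed
qed

end
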